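(* Let $\phi(\theta)=\mathbb{E}e^{i\theta X}$ be the characteristic function of a real random variable $X$ whose law on $\mathbb{R}$ is infinitely divisible, and let $\psi(\theta)=\log\phi(\theta)$ be its characteristic exponent. Let $H$ be a probability distribution function on $\mathbb{R}$ such that $H(0)=0$ and $H$ is concave on $[0,\infty)$. For $n\in\mathbb{N}$, $\theta_1,\ldots,\theta_n\in\mathbb{R}$ and real $t_1\le t_2\le\cdots\le t_n$ define $\phi_n$ by $$\log\phi_n(\theta_1,\ldots,\theta_n;t_1,\ldots,t_n)=\sum_{1\le i\le j\le n}\psi(\theta_i+\cdots+\theta_j)\left[H(t_j-t_{i-1})-H(t_j-t_i)-H(t_{j+1}-t_{i-1})+H(t_{j+1}-t_i)\right],$$ where, for each fixed $n$, $t_0:=-\infty$ and $t_{n+1}:=+\infty$. Then: (1) the functions $\phi_n(\,\cdot\,;t_1,\ldots,t_n)$ are the characteristic functions of infinitely divisible probability laws on $\mathbb{R}^n$, and this family of finite-dimensional distributions is consistent (in the sense of Kolmogorov); (2) the family corresponds to the finite-dimensional distributions of a stationary process $\{X_t;t\in\mathbb{R}\}$, i.e. $\mathbb{E}e^{i\sum_{k=1}^n\theta_kX_{t_k}}=\phi_n(\theta_1,\ldots,\theta_n;t_1,\ldots,t_n)$, with marginal distribution $\mathbb{E}e^{i\theta X_t}=\phi(\theta)$ for every $t\in\mathbb{R}$; (3) if $X$ has finite second moment, then for all $t,h\in\mathbb{R}$ $$\mathrm{Cov}(X_t,X_{t+h})=-\psi''(0)\left[1-H(|h|)\right].$$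
   Context: The characteristic exponent $\psi=\log\phi$ of an infinitely divisible law on $\mathbb{R}$ is the (unique continuous, vanishing at $0$) function of the form $$\psi(\theta)=i\beta\theta-\tfrac12\sigma^2\theta^2+\int_{\mathbb{R}\setminus\{0\}}\left(e^{i\theta x}-1-i\theta x\mathbf{1}(|x|<1)\right)\nu(dx),$$ where $(\beta,\sigma,\nu)$ is the Lévy triplet and $\nu$ is a Lévy measure on $\mathbb{R}\setminus\{0\}$ (i.e. $\int(x^2\wedge1)\,\nu(dx)<\infty$). With the conventions $t_0=-\infty$, $t_{n+1}=+\infty$, any difference $t_j-t_0$, $t_{n+1}-t_i$ or $t_{n+1}-t_0$ is $+\infty$, and $H(+\infty)=1$. "Stationary" means that all finite-dimensional distributions are invariant under time shifts. *)

theory Defs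
  imports "HOL-Probability.Probability"
begin

text \<open>The law of the sum of \<open>m\<close> independent copies with law \<open>\<nu>\<close> is the \<open>m\<close>-fold convolution power
  of \<open>\<nu>\<close>. The space \<open>\<real>\<^sup>n\<close> with varying \<open>n\<close> is the product
  \<open>\<Pi>\<^sub>M k\<in>{1..n}. borel\<close>, whose points are the extensional functions on \<open>{1..n}\<close>.\<close>

definition infinitely_divisible :: "real measure \<Rightarrow> bool" where
  "infinitely_divisible \<mu> \<longleftrightarrow> real_distribution \<mu> \<and>
     (\<forall>m::nat\<ge>1. \<exists>\<nu>. real_distribution \<nu> \<and>
        \<mu> = distr (\<Pi>\<^sub>M j\<in>{1..m}. \<nu>) borel (\<lambda>x. \<Sum>j=1..m. x j))"

abbreviation Rn :: "nat \<Rightarrow> (nat \<Rightarrow> real) measure" where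
  "Rn n \<equiv> (\<Pi>\<^sub>M k\<in>{1..n}. borel)"

definition prob_law :: "nat \<Rightarrow> (nat \<Rightarrow> real) measure \<Rightarrow> bool" where
  "prob_law n \<mu> \<longleftrightarrow> prob_space \<mu> \<and> sets \<mu> = sets (Rn n)"

definition infinitely_divisible_vec :: "nat \<Rightarrow> (nat \<Rightarrow> real) measure \<Rightarrow> bool" where
  "infinitely_divisible_vec n \<mu> \<longleftrightarrow> prob_law n \<mu> \<and>
     (\<forall>m::nat\<ge>1. \<exists>\<nu>. prob_law n \<nu> \<and>
        \<mu> = distr (\<Pi>\<^sub>M j\<in>{1..m}. \<nu>) (Rn n) (\<lambda>x. \<lambda>k\<in>{1..n}. \<Sum>j=1..m. x j k))"

definition char_vec :: "nat \<Rightarrow> (nat \<Rightarrow> real) measure \<Rightarrow> (nat \<Rightarrow> real) \<Rightarrow> complex" where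
  "char_vec n \<mu> \<theta> = (LINT x|\<mu>. iexp (\<Sum>k=1..n. \<theta> k * x k))"

text \<open>The logarithm of a characteristic function is its distinguished logarithm: the unique
  continuous one that vanishes at \<open>0\<close>. Below it is checked that this is the
  L\'evy--Khintchine exponent.\<close>

definition dist_log :: "(real \<Rightarrow> complex) \<Rightarrow> real \<Rightarrow> complex" where
  "dist_log \<phi> = (THE \<psi>. continuous_on UNIV \<psi> \<and> \<psi> 0 = 0 \<and> (\<forall>\<theta>. exp (\<psi> \<theta>) = \<phi> \<theta>))"

lemma dist_log_eqI:
  assumes "continuous_on UNIV \<psi>" "\<psi> 0 = 0" "\<And>\<theta>. exp (\<psi> \<theta>) = \<phi> \<theta>"
  shows "dist_log \<phi> = \<psi>"
  unfolding dist_log_def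
proof (rule the_equality)
  show "continuous_on UNIV \<psi> \<and> \<psi> 0 = 0 \<and> (\<forall>\<theta>. exp (\<psi> \<theta>) = \<phi> \<theta>)"
    using assms by blast
next
  fix \<eta> assume \<eta>: "continuous_on UNIV \<eta> \<and> \<eta> 0 = 0 \<and> (\<forall>\<theta>. exp (\<eta> \<theta>) = \<phi> \<theta>)"
  define f where "f = (\<lambda>\<theta>. \<eta> \<theta> - \<psi> \<theta>)"
  have cont: "continuous_on UNIV f"
    unfolding f_def using \<eta> assms(1) by (intro continuous_intros) auto
  have "exp (f \<theta>) = 1" for \<theta>
    using \<eta> assms(3)[of \<theta>] exp_not_eq_zero[of "\<psi> \<theta>"] by (auto simp: f_def exp_diff)
  then have f_form: "\<exists>k::int. f \<theta> = complex_of_real (2 * of_int k * pi) * \<i>" for \<theta>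
    using exp_eq[of "f \<theta>" 0] by auto
  have "f constant_on UNIV"
  proof (rule continuous_discrete_range_constant[OF connected_UNIV cont])
    fix x :: real
    have "2 * pi \<le> norm (f y - f x)" if ne: "f y \<noteq> f x" for y
    proof -
      obtain k l :: int where k: "f y = complex_of_real (2 * of_int k * pi) * \<i>"
        and l: "f x = complex_of_real (2 * of_int l * pi) * \<i>"
        using f_form by blast
      have "f y - f x = complex_of_real (2 * of_int (k - l) * pi) * \<i>"
        by (simp add: k l algebra_simps)
      then have eq: "norm (f y - f x) = \<bar>real_of_int (k - l)\<bar> * (2 * pi)"
        by (simp only: norm_mult norm_of_real norm_ii abs_mult) simp
      have "k \<noteq> l" using ne k l by auto
      then have "1 \<le> \<bar>real_of_int (k - l)\<bar>" by linarith
      then have "1 * (2 * pi) \<le> \<bar>real_of_int (k - l)\<bar> * (2 * pi)"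
        by (intro mult_right_mono) auto
      then show ?thesis by (simp add: eq)
    qed
    then show "\<exists>e>0. \<forall>y. y \<in> UNIV \<and> f y \<noteq> f x \<longrightarrow> e \<le> norm (f y - f x)"
      by (intro exI[of _ "2 * pi"]) auto
  qed
  then have "f \<theta> = f 0" for \<theta>
    by (auto simp: constant_on_def)
  then show "\<eta> = \<psi>" using \<eta> assms(2) by (auto simp: f_def)
qed

definition levy_measure :: "real measure \<Rightarrow> bool" where
  "levy_measure \<nu> \<longleftrightarrow> sets \<nu> = sets borel \<and> emeasure \<nu> {0} = 0 \<and>
     integrable \<nu> (\<lambda>x. min (x\<^sup>2) 1)"

definition levy_khintchine :: "real \<Rightarrow> real \<Rightarrow> real measure \<Rightarrow> real \<Rightarrow> complex" where
  "levy_khintchine \<beta> \<sigma> \<nu> \<theta> = \<i> * of_real (\<beta> * \<theta>) - of_real (\<sigma>\<^sup>2 * \<theta>\<^sup>2 / 2)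
     + (LINT x|\<nu>. iexp (\<theta> * x) - 1 - \<i> * of_real (\<theta> * x * indicator {-1<..<1} x))"

lemma continuous_levy_khintchine:
  assumes "levy_measure \<nu>"
  shows "continuous_on UNIV (levy_khintchine \<beta> \<sigma> \<nu>)"
proof -
  note \<nu> = assms[unfolded levy_measure_def]
  have [measurable_cong]: "sets \<nu> = sets borel" using \<nu> by blast
  define g where "g = (\<lambda>\<theta> x::real. iexp (\<theta> * x) - 1 - \<i> * of_real (\<theta> * x * indicator {-1<..<1} x))"
  have bound: "norm (g \<theta> x) \<le> (\<theta>\<^sup>2 + 2) * min (x\<^sup>2) 1" for \<theta> x
  proof (cases "\<bar>x\<bar> < 1")
    case True
    then have x2: "min (x\<^sup>2) 1 = x\<^sup>2" by (simp add: abs_square_le_1)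
    have "g \<theta> x = iexp (\<theta> * x) - (\<Sum>k\<le>1. (\<i> * of_real (\<theta> * x))^k / fact k)"
      using True by (auto simp: g_def indicator_def abs_less_iff)
    then have "norm (g \<theta> x) \<le> \<bar>\<theta> * x\<bar>^2 / 2"
      using iexp_approx1[of "\<theta> * x" 1] by (simp add: numeral_2_eq_2)
    also have "\<dots> \<le> (\<theta>\<^sup>2 + 2) * x\<^sup>2"
      by (simp add: power_mult_distrib algebra_simps)
    finally show ?thesis by (simp add: x2)
  next
    case False
    then have "min (x\<^sup>2) 1 = 1" using abs_square_less_1[of x] by auto
    moreover have "norm (g \<theta> x) \<le> 2"
      using False norm_triangle_ineq4[of "iexp (\<theta> * x)" 1] by (auto simp: g_def indicator_def)
    ultimately show ?thesis by (smt (verit) mult_cancel_left2 zero_le_power2)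
  qed
  have "isCont (\<lambda>\<theta>. LINT x|\<nu>. g \<theta> x) \<theta>0" for \<theta>0
    unfolding continuous_at_sequentially comp_def
  proof safe
    fix s :: "nat \<Rightarrow> real" assume s: "s \<longlonglongrightarrow> \<theta>0"
    then have "Bseq s" using convergent_imp_Bseq convergentI by blast
    then obtain K where K: "\<And>n. \<bar>s n\<bar> \<le> K" unfolding Bseq_def by auto
    show "(\<lambda>n. LINT x|\<nu>. g (s n) x) \<longlonglongrightarrow> (LINT x|\<nu>. g \<theta>0 x)"
    proof (rule integral_dominated_convergence[where w="\<lambda>x. (K\<^sup>2 + 2) * min (x\<^sup>2) 1"])
      show "integrable \<nu> (\<lambda>x. (K\<^sup>2 + 2) * min (x\<^sup>2) 1)" using \<nu> by simp
      show "AE x in \<nu>. (\<lambda>n. g (s n) x) \<longlonglongrightarrow> g \<theta>0 x"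
        unfolding g_def by (intro AE_I2 tendsto_intros s)
      show "AE x in \<nu>. norm (g (s n) x) \<le> (K\<^sup>2 + 2) * min (x\<^sup>2) 1" for n
      proof (rule AE_I2)
        fix x
        have "(s n)\<^sup>2 \<le> K\<^sup>2" using K[of n] by (meson abs_ge_zero order_trans power2_le_iff_abs_le)
        then have "((s n)\<^sup>2 + 2) * min (x\<^sup>2) 1 \<le> (K\<^sup>2 + 2) * min (x\<^sup>2) 1"
          by (intro mult_right_mono) auto
        then show "norm (g (s n) x) \<le> (K\<^sup>2 + 2) * min (x\<^sup>2) 1"
          using bound[of "s n" x] by linarith
      qed
    qed (auto simp: g_def)
  qed
  then have "continuous_on UNIV (\<lambda>\<theta>. LINT x|\<nu>. g \<theta> x)"
    by (simp add: continuous_on_eq_continuous_at)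
  then show ?thesis
    unfolding levy_khintchine_def[abs_def] g_def by (intro continuous_intros) auto
qed

lemma dist_log_eq_levy_khintchine:
  assumes "levy_measure \<nu>" "\<And>\<theta>. exp (levy_khintchine \<beta> \<sigma> \<nu> \<theta>) = \<phi> \<theta>"
  shows "dist_log \<phi> = levy_khintchine \<beta> \<sigma> \<nu>"
  by (rule dist_log_eqI[OF continuous_levy_khintchine[OF assms(1)] _ assms(2)])
     (simp add: levy_khintchine_def)

text \<open>The time points \<open>t\<^sub>1, \<dots>, t\<^sub>n\<close> are extended by \<open>t\<^sub>0 = -\<infinity>\<close> and \<open>t\<^sub>n\<^sub>+\<^sub>1 = \<infinity>\<close>, and \<open>H\<close> by
  \<open>H(\<infinity>) = 1\<close>. With \<open>1 \<le> i \<le> j \<le> n\<close>, no difference below has the form \<open>\<infinity> - \<infinity>\<close> or the value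
  \<open>-\<infinity>\<close>.\<close>

definition ext_time :: "nat \<Rightarrow> (nat \<Rightarrow> real) \<Rightarrow> nat \<Rightarrow> ereal" where
  "ext_time n t i = (if i = 0 then -\<infinity> else if i \<le> n then ereal (t i) else \<infinity>)"

definition ext_df :: "(real \<Rightarrow> real) \<Rightarrow> ereal \<Rightarrow> real" where
  "ext_df H x = (if x = \<infinity> then 1 else H (real_of_ereal x))"

definition fdd_log_char ::
  "(real \<Rightarrow> complex) \<Rightarrow> (real \<Rightarrow> real) \<Rightarrow> nat \<Rightarrow> (nat \<Rightarrow> real) \<Rightarrow> (nat \<Rightarrow> real) \<Rightarrow> complex" where
  "fdd_log_char \<psi> H n \<theta> t =
     (let T = ext_time n t; G = ext_df H in
      \<Sum>j=1..n. \<Sum>i=1..j. \<psi> (\<Sum>k=i..j. \<theta> k) *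
        of_real (G (T j - T (i - 1)) - G (T j - T i) - G (T (j + 1) - T (i - 1)) + G (T (j + 1) - T i)))"

definition fdd_char ::
  "(real \<Rightarrow> complex) \<Rightarrow> (real \<Rightarrow> real) \<Rightarrow> nat \<Rightarrow> (nat \<Rightarrow> real) \<Rightarrow> (nat \<Rightarrow> real) \<Rightarrow> complex" where
  "fdd_char \<psi> H n \<theta> t = exp (fdd_log_char \<psi> H n \<theta> t)"

text \<open>Only \<open>t 1, \<dots>, t n\<close> matter in the following.\<close>

abbreviation ordered_times :: "nat \<Rightarrow> (nat \<Rightarrow> real) \<Rightarrow> bool" where
  "ordered_times n t \<equiv> mono_on {1..n} t"

text \<open>Kolmogorov consistency of a family \<open>\<mu> n t\<close> of laws on \<open>\<real>\<^sup>n\<close> given for ordered \<open>t\<close>: whenever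
  the times \<open>s\<close> are \<open>t \<circ> f\<close> for an injective choice \<open>f\<close> of indices, \<open>\<mu> m s\<close> is the image of \<open>\<mu> n t\<close>
  under the coordinate map \<open>x \<mapsto> x \<circ> f\<close>. For increasing \<open>f\<close> this is compatibility with
  marginals; since \<open>s\<close> is ordered, \<open>f\<close> can only permute indices of equal times.\<close>

definition kolmogorov_consistent :: "(nat \<Rightarrow> (nat \<Rightarrow> real) \<Rightarrow> (nat \<Rightarrow> real) measure) \<Rightarrow> bool" where
  "kolmogorov_consistent \<mu> \<longleftrightarrow>
     (\<forall>m n s t f. 1 \<le> m \<and> 1 \<le> n \<and> ordered_times m s \<and> ordered_times n t \<and>
        f ` {1..m} \<subseteq> {1..n} \<and> inj_on f {1..m} \<and> (\<forall>k\<in>{1..m}. s k = t (f k)) \<longrightarrow>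
        \<mu> m s = distr (\<mu> n t) (Rn m) (\<lambda>x. \<lambda>k\<in>{1..m}. x (f k)))"

definition real_process :: "'w measure \<Rightarrow> (real \<Rightarrow> 'w \<Rightarrow> real) \<Rightarrow> bool" where
  "real_process M X \<longleftrightarrow> prob_space M \<and> (\<forall>t. X t \<in> borel_measurable M)"

definition joint_law ::
  "'w measure \<Rightarrow> (real \<Rightarrow> 'w \<Rightarrow> real) \<Rightarrow> nat \<Rightarrow> (nat \<Rightarrow> real) \<Rightarrow> (nat \<Rightarrow> real) measure" where
  "joint_law M X n t = distr M (Rn n) (\<lambda>\<omega>. \<lambda>k\<in>{1..n}. X (t k) \<omega>)"

definition stationary :: "'w measure \<Rightarrow> (real \<Rightarrow> 'w \<Rightarrow> real) \<Rightarrow> bool" where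
  "stationary M X \<longleftrightarrow> (\<forall>h n t. joint_law M X n (\<lambda>k. t k + h) = joint_law M X n t)"

definition has_fdd_char :: "'w measure \<Rightarrow> (real \<Rightarrow> 'w \<Rightarrow> real) \<Rightarrow>
    (nat \<Rightarrow> (nat \<Rightarrow> real) \<Rightarrow> (nat \<Rightarrow> real) \<Rightarrow> complex) \<Rightarrow> bool" where
  "has_fdd_char M X \<Phi> \<longleftrightarrow>
     (\<forall>n\<ge>1. \<forall>t. ordered_times n t \<longrightarrow>
        (\<forall>\<theta>. (LINT \<omega>|M. iexp (\<Sum>k=1..n. \<theta> k * X (t k) \<omega>)) = \<Phi> n \<theta> t))"

definition covariance :: "'w measure \<Rightarrow> ('w \<Rightarrow> real) \<Rightarrow> ('w \<Rightarrow> real) \<Rightarrow> real" where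
  "covariance M Y Z =
     (LINT \<omega>|M. (Y \<omega> - (LINT \<omega>'|M. Y \<omega>')) * (Z \<omega> - (LINT \<omega>'|M. Z \<omega>')))"

end

theory Submission
  imports Defs
begin

text \<open>
  The exponent of \<open>\<phi>\<^sub>n\<close> is what a random measure would produce. Picture an independently scattered
  random measure \<open>\<Lambda>\<close> on pairs (birth, death) such that \<open>\<Lambda> B\<close> has the law with exponent
  \<open>m B * \<psi>\<close>, and let \<open>X t\<close> be the value of \<open>\<Lambda>\<close> on the pairs alive at time \<open>t\<close>. Then
  the sum of the \<open>\<theta>\<^sub>k * X (t\<^sub>k)\<close> sees a pair only through the first index \<open>i\<close> and the last index \<open>j\<close> at which it is
  alive, and gives it the coefficient \<open>\<theta>\<^sub>i + \<dots> + \<theta>\<^sub>j\<close>. The bracket in the formula is the \<open>m\<close>-mass of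
  that cell, a rectangular increment of \<open>(a, b) \<mapsto> H (b - a)\<close>; it is nonnegative because \<open>H\<close>
  is nondecreasing and concave. No such \<open>\<Lambda>\<close> has to be built: for finitely many times there are
  finitely many cells, and finitely many independent variables suffice.

  Three facts carry the argument. First, \<open>exp (c * \<psi>)\<close> is a characteristic function for every real
  \<open>c \<ge> 0\<close> (\<open>infinitely_divisible_exp_scaled\<close>): roots and convolution powers give rational \<open>c\<close>,
  and the limit is taken by the continuity theorem, including its tightness part. Hence the
  independent cell variables exist (\<open>ex_law_of_interval_sums\<close>), and replacing \<open>\<psi>\<close> by \<open>\<psi> / m\<close> gives
  the \<open>m\<close>-th convolution roots of the laws on \<open>\<real>\<^sup>n\<close>. Second, a law on \<open>\<real>\<^sup>n\<close> is determined by its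
  characteristic function (\<open>prob_law_eqI\<close>), so that every identity between laws becomes one
  between exponents. Third, the exponent does not change when the time grid is refined
  and the new coefficients are 0 (\<open>fdd_log_char_refine\<close>), since cell masses telescope. This yields
  consistency, also with repeated times, and Kolmogorov's extension theorem gives the process. It is
  stationary because only differences of times enter the exponent.

  For the covariance, only pairs alive at exactly one of the times \<open>t\<close> and \<open>t + h\<close> contribute to
  \<open>X t - X (t + h)\<close>, whose exponent for \<open>h \<ge> 0\<close> is therefore \<open>H h * (\<psi> \<theta> + \<psi> (- \<theta>))\<close>. Two derivatives at 0 give
  \<open>E (X t - X (t + h))\<^sup>2 = - 2 * H h * \<psi>'' 0\<close>, and polarisation gives the covariance.
\<close>

section \<open>Real convolution powers of an infinitely divisible law\<close>

lemma integral_iexp_sum_PiM: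
  fixes f :: "'i \<Rightarrow> 'b \<Rightarrow> real"
  assumes "finite I" and N: "\<And>i. prob_space (N i)"
    and f: "\<And>i. i \<in> I \<Longrightarrow> f i \<in> borel_measurable (N i)"
  shows "(LINT x|PiM I N. iexp (\<Sum>i\<in>I. f i (x i))) = (\<Prod>i\<in>I. LINT y|N i. iexp (f i y))"
proof -
  interpret product_sigma_finite N
    by (rule product_sigma_finite.intro) (rule prob_space_imp_sigma_finite[OF N])
  have "(LINT x|PiM I N. iexp (\<Sum>i\<in>I. f i (x i))) = (LINT x|PiM I N. (\<Prod>i\<in>I. iexp (f i (x i))))"
    using \<open>finite I\<close> by (simp add: exp_sum sum_distrib_left)
  also have "\<dots> = (\<Prod>i\<in>I. LINT y|N i. iexp (f i y))"
    using \<open>finite I\<close> f prob_space.integrable_iexp[OF N]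
    by (intro product_integral_prod) auto
  finally show ?thesis .
qed

lemma char_distr_PiM_sum:
  assumes "finite I" and N: "\<And>i. real_distribution (N i)"
  shows "real_distribution (distr (PiM I N) borel (\<lambda>x. \<Sum>i\<in>I. x i))"
    and "char (distr (PiM I N) borel (\<lambda>x. \<Sum>i\<in>I. x i)) \<theta> = (\<Prod>i\<in>I. char (N i) \<theta>)"
proof -
  have P: "prob_space (N i)" and S[measurable_cong]: "sets (N i) = sets borel" for i
    using N[of i] by (auto simp: real_distribution_def real_distribution_axioms_def)
  show "real_distribution (distr (PiM I N) borel (\<lambda>x. \<Sum>i\<in>I. x i))"
    by (intro prob_space.real_distribution_distr[OF prob_space_PiM[OF P]]) measurable
  show "char (distr (PiM I N) borel (\<lambda>x. \<Sum>i\<in>I. x i)) \<theta> = (\<Prod>i\<in>I. char (N i) \<theta>)"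
    unfolding char_def
    using integral_iexp_sum_PiM[OF \<open>finite I\<close> P, of "\<lambda>i x. \<theta> * x"]
    by (subst integral_distr) (auto simp: sum_distrib_left)
qed

text \<open>After a rotation that makes the characteristic function at \<open>\<theta>\<close> real and nonnegative, this is the
  expectation of \<open>cos (2 * y) \<ge> 4 * cos y - 3\<close>, which is \<open>2 * (cos y - 1)\<^sup>2 \<ge> 0\<close>. It shows that a
  characteristic function of modulus close to 1 at \<open>\<theta>\<close> cannot vanish at \<open>2 * \<theta>\<close>.\<close>
lemma (in real_distribution) cmod_char_double:
  "4 * cmod (char M \<theta>) - 3 \<le> cmod (char M (2 * \<theta>))"
proof -
  define \<alpha> where "\<alpha> = Arg (char M \<theta>)"
  have int: "integrable M (\<lambda>x. iexp (a * x + b))" for a b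
    using integrable_iexp[of "\<lambda>x. a * x + b"] by simp
  have intc: "integrable M (\<lambda>x. cos (a * x + b))" for a b
    using integrable_Re[OF int[of a b]] by (simp add: Re_exp)
  have rot: "(LINT x|M. cos (a * x + b)) = Re (iexp b * char M a)" for a b
  proof -
    have "(LINT x|M. cos (a * x + b)) = (LINT x|M. Re (iexp (a * x + b)))"
      by (simp add: Re_exp)
    also have "\<dots> = Re (LINT x|M. iexp (a * x + b))"
      by (rule integral_Re[OF int])
    also have "(LINT x|M. iexp (a * x + b)) = (LINT x|M. iexp b * iexp (a * x))"
      by (simp add: exp_add[symmetric] algebra_simps)
    also have "\<dots> = iexp b * char M a"
      by (simp add: char_def)
    finally show ?thesis .
  qed
  have "iexp (-\<alpha>) * char M \<theta> = cmod (char M \<theta>)"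
  proof -
    have "char M \<theta> = cmod (char M \<theta>) * iexp \<alpha>"
      unfolding \<alpha>_def by (metis Arg_eq Arg_zero mult_zero_left norm_zero of_real_0)
    then have "iexp (-\<alpha>) * char M \<theta> = cmod (char M \<theta>) * (iexp (-\<alpha>) * iexp \<alpha>)"
      by (metis (no_types) mult.left_commute)
    then show ?thesis by (simp add: exp_add[symmetric])
  qed
  then have 1: "(LINT x|M. cos (\<theta> * x + -\<alpha>)) = cmod (char M \<theta>)"
    unfolding rot by simp
  have "4 * cos y - 3 \<le> cos (2 * y)" for y :: real
    using zero_le_power2[of "cos y - 1"] cos_double_cos[of y]
    by (simp add: power2_eq_square algebra_simps)
  moreover have "(2 * \<theta>) * x + - 2 * \<alpha> = 2 * (\<theta> * x + -\<alpha>)" for x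
    by (simp add: algebra_simps)
  ultimately have le: "4 * cos (\<theta> * x + -\<alpha>) - 3 \<le> cos ((2 * \<theta>) * x + - 2 * \<alpha>)" for x
    by metis
  have "4 * cmod (char M \<theta>) - 3 = (LINT x|M. 4 * cos (\<theta> * x + -\<alpha>) - 3)"
    using intc[of \<theta> "-\<alpha>"] prob_space by (simp add: 1[symmetric])
  also have "\<dots> \<le> (LINT x|M. cos ((2 * \<theta>) * x + - 2 * \<alpha>))"
    by (intro integral_mono le) (use intc[of \<theta> "-\<alpha>"] intc[of "2 * \<theta>" "-2 * \<alpha>"] in auto)
  also have "\<dots> = Re (iexp (-2 * \<alpha>) * char M (2 * \<theta>))"
    by (rule rot)
  also have "\<dots> \<le> cmod (iexp (-2 * \<alpha>) * char M (2 * \<theta>))"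
    by (rule complex_Re_le_cmod)
  also have "\<dots> = cmod (char M (2 * \<theta>))"
    by (simp add: norm_mult)
  finally show ?thesis .
qed

lemma infinitely_divisible_root:
  assumes "infinitely_divisible \<mu>" "1 \<le> (m::nat)"
  obtains \<nu> where "real_distribution \<nu>" "\<And>\<theta>. char \<mu> \<theta> = char \<nu> \<theta> ^ m"
  using assms char_distr_PiM_sum(2)[of "{1..m}" "\<lambda>_. \<nu>" for \<nu>]
  unfolding infinitely_divisible_def by (metis card_atLeastAtMost diff_Suc_1 finite_atLeastAtMost prod_constant)

text \<open>At a point where \<open>char \<mu>\<close> does not vanish, its \<open>m\<close>-th roots have modulus tending to 1, so
  \<open>cmod_char_double\<close> excludes a zero at the doubled point. Starting close to 0, where \<open>char \<mu>\<close>
  is near 1, repeated doubling reaches every point.\<close>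
lemma infinitely_divisible_char_nonzero:
  assumes "infinitely_divisible \<mu>"
  shows "char \<mu> \<theta> \<noteq> 0"
proof -
  interpret real_distribution \<mu>
    using assms by (simp add: infinitely_divisible_def)
  have double: "char \<mu> (2 * \<theta>) \<noteq> 0" if nz: "char \<mu> \<theta> \<noteq> 0" for \<theta>
  proof
    assume z: "char \<mu> (2 * \<theta>) = 0"
    have "cmod (char \<mu> \<theta>) powr (1 / Suc m) \<le> 3/4" for m
    proof -
      obtain \<nu> where \<nu>: "real_distribution \<nu>" "\<And>\<theta>. char \<mu> \<theta> = char \<nu> \<theta> ^ Suc m"
        using infinitely_divisible_root[OF assms, of "Suc m"] by auto
      have "char \<nu> (2 * \<theta>) = 0" using z \<nu>(2)[of "2 * \<theta>"] by (metis power_not_zero)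
      then have "cmod (char \<nu> \<theta>) \<le> 3/4"
        using real_distribution.cmod_char_double[OF \<nu>(1), of \<theta>] by simp
      moreover have "char \<nu> \<theta> \<noteq> 0" using nz \<nu>(2)[of \<theta>] by simp
      then have "cmod (char \<mu> \<theta>) powr (1 / Suc m) = cmod (char \<nu> \<theta>)"
        unfolding \<nu>(2)[of \<theta>] norm_power
        by (subst powr_realpow[symmetric]) (auto simp: powr_powr simp del: power_Suc of_nat_Suc)
      ultimately show ?thesis by simp
    qed
    moreover have "(\<lambda>m. cmod (char \<mu> \<theta>) powr (1 / Suc m)) \<longlonglongrightarrow> cmod (char \<mu> \<theta>) powr 0"
      using nz by (intro tendsto_powr tendsto_const LIMSEQ_Suc[OF lim_1_over_n]) auto
    ultimately have "cmod (char \<mu> \<theta>) powr 0 \<le> 3/4"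
      by (intro LIMSEQ_le_const2) auto
    then show False using nz by simp
  qed
  have "(\<lambda>k. char \<mu> (\<theta> / 2^k)) \<longlonglongrightarrow> char \<mu> 0"
  proof (rule isCont_tendsto_compose[OF isCont_char])
    show "(\<lambda>k. \<theta> / 2^k) \<longlonglongrightarrow> 0" by real_asymp
  qed
  then have "\<forall>\<^sub>F k in sequentially. char \<mu> (\<theta> / 2^k) \<noteq> 0"
    by (rule tendsto_imp_eventually_ne) (simp add: char_zero)
  then obtain k where k: "char \<mu> (\<theta> / 2^k) \<noteq> 0"
    by (auto simp: eventually_sequentially)
  have "char \<mu> (2^l * (\<theta> / 2^k)) \<noteq> 0" for l
  proof (induction l)
    case (Suc l)
    then show ?case using double[OF Suc] by (simp only: power_Suc mult.assoc not_False_eq_True)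
  qed (use k in simp)
  from this[of k] show ?thesis by simp
qed

text \<open>A continuous function on the line without zeros has a continuous logarithm; normalised at 0 it is
  the distinguished one.\<close>
lemma dist_log_char:
  assumes "infinitely_divisible \<mu>"
  shows "continuous_on UNIV (dist_log (char \<mu>))" and "dist_log (char \<mu>) 0 = 0"
    and "exp (dist_log (char \<mu>) \<theta>) = char \<mu> \<theta>"
proof -
  interpret real_distribution \<mu>
    using assms by (simp add: infinitely_divisible_def)
  obtain g where g: "continuous_on UNIV g" "\<And>\<theta>. char \<mu> \<theta> = exp (g \<theta>)"
    using continuous_logarithm_on_contractible[of UNIV "char \<mu>"]
      infinitely_divisible_char_nonzero[OF assms] isCont_char
    by (metis UNIV_I contractible_UNIV continuous_at_imp_continuous_on)
  have "exp (g 0) = 1" using g(2)[of 0] by (simp add: char_zero)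
  then have "dist_log (char \<mu>) = (\<lambda>\<theta>. g \<theta> - g 0)"
    by (intro dist_log_eqI continuous_intros g) (auto simp: exp_diff g)
  with g \<open>exp (g 0) = 1\<close> show "continuous_on UNIV (dist_log (char \<mu>))"
    and "dist_log (char \<mu>) 0 = 0" and "exp (dist_log (char \<mu>) \<theta>) = char \<mu> \<theta>"
    by (auto simp: exp_diff intro!: continuous_intros)
qed

text \<open>The quotient of the two candidates for the root is a continuous function with values in the finite set
  of \<open>m\<close>-th roots of unity, hence constant.\<close>
lemma root_eq_exp:
  fixes \<xi> \<eta> :: "real \<Rightarrow> complex"
  assumes "continuous_on UNIV \<xi>" "continuous_on UNIV \<eta>" "\<xi> 0 = 1" "\<eta> 0 = 0"
    and m: "1 \<le> m" and eq: "\<And>\<theta>. \<xi> \<theta> ^ m = exp (of_nat m * \<eta> \<theta>)"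
  shows "\<xi> \<theta> = exp (\<eta> \<theta>)"
proof -
  define u where "u = (\<lambda>\<theta>. \<xi> \<theta> / exp (\<eta> \<theta>))"
  have "continuous_on UNIV u"
    unfolding u_def by (intro continuous_intros assms) auto
  moreover have "u \<theta> ^ m = 1" for \<theta>
    by (simp add: u_def power_divide eq exp_of_nat_mult)
  then have "finite (u ` UNIV)"
    by (intro finite_subset[OF _ finite_roots_unity[OF m]]) auto
  ultimately have "u constant_on UNIV"
    using continuous_finite_range_constant[OF connected_UNIV] by blast
  then have "u \<theta> = u 0"
    by (auto simp: constant_on_def)
  then show ?thesis by (simp add: u_def assms field_simps)
qed

text \<open>Averaging the characteristic function over a Gaussian argument turns it, by Fubini, into
  \<open>E exp (- (s * x)\<^sup>2 / 2)\<close>. The factor 3 comes from \<open>1 - exp (- 1 / 2) \<ge> 1 / 3\<close>.\<close>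
lemma (in real_distribution) tail_le_char:
  assumes "s > 0"
  shows "measure M {x. 1 / s \<le> \<bar>x\<bar>}
    \<le> 3 * (LINT z|std_normal_distribution. 1 - Re (char M (s * z)))"
proof -
  interpret N: real_distribution std_normal_distribution by (rule real_dist_normal_dist)
  interpret NM: pair_prob_space std_normal_distribution M ..
  have intc: "integrable std_normal_distribution (\<lambda>z. char M (s * z))"
    by (rule N.integrable_const_bound[where B=1]) (auto simp: cmod_char_le_1)
  have int: "integrable M (\<lambda>x. exp (- ((s * x)\<^sup>2 / 2)))"
    by (rule integrable_const_bound[where B=1]) auto
  have "(LINT z|std_normal_distribution. char M (s * z))
      = (LINT z|std_normal_distribution. LINT x|M. iexp (s * x * z))"
    unfolding char_def by (simp add: mult_ac)
  also have "\<dots> = (LINT x|M. LINT z|std_normal_distribution. iexp (s * x * z))"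
    by (intro NM.Fubini_integral[symmetric] NM.P.integrable_const_bound[where B=1])
       (auto simp: split_beta)
  also have "\<dots> = (LINT x|M. complex_of_real (exp (- ((s * x)\<^sup>2 / 2))))"
  proof (rule Bochner_Integration.integral_cong[OF refl])
    fix x
    show "(LINT z|std_normal_distribution. iexp (s * x * z)) = complex_of_real (exp (- ((s * x)\<^sup>2 / 2)))"
      using fun_cong[OF char_std_normal_distribution, of "s * x"] by (simp add: char_def)
  qed
  also have "\<dots> = complex_of_real (LINT x|M. exp (- ((s * x)\<^sup>2 / 2)))"
    by simp
  finally have avg: "Re (LINT z|std_normal_distribution. char M (s * z))
      = (LINT x|M. exp (- ((s * x)\<^sup>2 / 2)))"
    by simp
  have "indicator {x. 1 / s \<le> \<bar>x\<bar>} x \<le> 3 * (1 - exp (- ((s * x)\<^sup>2 / 2)))" for x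
  proof (cases "1 / s \<le> \<bar>x\<bar>")
    case True
    then have "1 \<le> \<bar>s * x\<bar>" using assms by (simp add: field_simps abs_mult)
    then have "1 \<le> (s * x)\<^sup>2" by (simp add: abs_le_square_iff[of 1, simplified])
    then have "3 / 2 \<le> exp ((s * x)\<^sup>2 / 2)"
      using exp_ge_add_one_self[of "(s * x)\<^sup>2 / 2"] by linarith
    then have "exp (- ((s * x)\<^sup>2 / 2)) \<le> 2 / 3"
      by (simp add: exp_minus field_simps)
    then show ?thesis using True by simp
  qed auto
  then have "(LINT x|M. indicator {x. 1 / s \<le> \<bar>x\<bar>} x) \<le> (LINT x|M. 3 * (1 - exp (- ((s * x)\<^sup>2 / 2))))"
    using int by (intro integral_mono integrable_const_bound[where B=1 and f="indicator _"]) auto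
  also have "\<dots> = 3 * (1 - (LINT x|M. exp (- ((s * x)\<^sup>2 / 2))))"
    using int prob_space by simp
  also have "\<dots> = 3 * (LINT z|std_normal_distribution. 1 - Re (char M (s * z)))"
    using intc N.prob_space by (simp add: avg[symmetric])
  finally show ?thesis by simp
qed

lemma (in real_distribution) ex_interval_mass_gt:
  assumes "\<epsilon> > 0"
  obtains b where "b > 0" "measure M {-b<..b} > 1 - \<epsilon>"
proof -
  have "(\<lambda>n. measure M {-real n<..real n}) \<longlonglongrightarrow> measure M (\<Union>n. {-real n<..real n})"
    by (intro finite_Lim_measure_incseq) (auto simp: incseq_def)
  also have "(\<Union>n. {-real n<..real n}) = UNIV"
  proof safe
    fix x :: real
    obtain n :: nat where "\<bar>x\<bar> < real n" using reals_Archimedean2 by blast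
    then show "x \<in> (\<Union>n. {-real n<..real n})" by (intro UN_I[of n]) auto
  qed auto
  finally have "(\<lambda>n. measure M {-real n<..real n}) \<longlonglongrightarrow> 1"
    using prob_space by simp
  then have "\<forall>\<^sub>F n in sequentially. measure M {-real n<..real n} > 1 - \<epsilon>"
    using assms by (intro order_tendstoD) auto
  then have "\<forall>\<^sub>F n in sequentially. real n > 0 \<and> measure M {-real n<..real n} > 1 - \<epsilon>"
    using eventually_gt_at_top[of 0] by eventually_elim simp
  then show ?thesis using that unfolding eventually_sequentially by (metis le_refl of_nat_0_less_iff)
qed

text \<open>By \<open>tail_le_char\<close> the tails are bounded by Gaussian averages of \<open>1 - Re (char (\<nu> n))\<close>, which converge
  to those of \<open>1 - Re \<xi>\<close>; these are small for small scales because \<open>\<xi>\<close> is continuous at 0 with value 1.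
  The finitely many \<open>n\<close> before the limit is close are handled one by one.\<close>
lemma tight_if_char_tendsto:
  assumes \<nu>: "\<And>n. real_distribution (\<nu> n)"
    and lim: "\<And>\<theta>. (\<lambda>n. char (\<nu> n) \<theta>) \<longlonglongrightarrow> \<xi> \<theta>" and cont: "isCont \<xi> 0"
  shows "tight \<nu>"
  unfolding tight_def
proof safe
  fix \<epsilon> :: real assume "\<epsilon> > 0"
  interpret N: real_distribution std_normal_distribution by (rule real_dist_normal_dist)
  interpret \<nu>: real_distribution "\<nu> n" for n by (rule \<nu>)
  define R where "R \<xi> s = (LINT z|std_normal_distribution. 1 - Re (\<xi> (s * z)))"
    for \<xi> :: "real \<Rightarrow> complex" and s
  have [measurable]: "\<xi> \<in> borel_measurable borel"
    by (rule borel_measurable_LIMSEQ_metric[OF _ lim]) simp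
  have bd: "cmod (\<xi> \<theta>) \<le> 1" for \<theta>
    by (rule LIMSEQ_le_const2[OF tendsto_norm[OF lim]]) (auto simp: \<nu>.cmod_char_le_1)
  have \<xi>0: "\<xi> 0 = 1"
    using LIMSEQ_unique[OF lim[of 0]] by (simp add: \<nu>.char_zero)
  have bound: "\<bar>1 - Re z\<bar> \<le> 2" if "cmod z \<le> 1" for z
    using abs_Re_le_cmod[of z] that by linarith
  have "(\<lambda>k. R \<xi> (1 / Suc k)) \<longlonglongrightarrow> (LINT z|std_normal_distribution. 0)"
    unfolding R_def
  proof (rule integral_dominated_convergence[where w="\<lambda>_. 2"])
    show "AE z in std_normal_distribution. (\<lambda>k. 1 - Re (\<xi> (1 / Suc k * z))) \<longlonglongrightarrow> 0"
    proof (rule AE_I2)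
      fix z :: real
      have "(\<lambda>k. 1 / Suc k * z) \<longlonglongrightarrow> 0 * z"
        by (intro tendsto_intros LIMSEQ_Suc[OF lim_1_over_n])
      then have "(\<lambda>k. \<xi> (1 / Suc k * z)) \<longlonglongrightarrow> 1"
        using isCont_tendsto_compose[OF cont] by (simp add: \<xi>0)
      then have "(\<lambda>k. 1 - Re (\<xi> (1 / Suc k * z))) \<longlonglongrightarrow> 1 - Re 1"
        by (intro tendsto_intros)
      then show "(\<lambda>k. 1 - Re (\<xi> (1 / Suc k * z))) \<longlonglongrightarrow> 0" by simp
    qed
  qed (use bound[OF bd] in auto)
  then have "\<forall>\<^sub>F k in sequentially. R \<xi> (1 / Suc k) < \<epsilon> / 3"
    using \<open>\<epsilon> > 0\<close> by (intro order_tendstoD) auto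
  then obtain k where k: "R \<xi> (1 / Suc k) < \<epsilon> / 3"
    by (auto simp: eventually_sequentially)
  define s where "s = 1 / real (Suc k)"
  have "s > 0" by (simp add: s_def)
  have "(\<lambda>n. R (char (\<nu> n)) s) \<longlonglongrightarrow> R \<xi> s"
    unfolding R_def
    by (rule integral_dominated_convergence[where w="\<lambda>_. 2"])
       (auto intro!: tendsto_intros lim bound simp: \<nu>.cmod_char_le_1)
  then have "\<forall>\<^sub>F n in sequentially. R (char (\<nu> n)) s < \<epsilon> / 3"
    using k unfolding s_def[symmetric] by (intro order_tendstoD) auto
  then obtain n0 where n0: "\<And>n. n \<ge> n0 \<Longrightarrow> R (char (\<nu> n)) s < \<epsilon> / 3"
    by (auto simp: eventually_sequentially)
  have "\<exists>b>0. measure (\<nu> n) {-b<..b} > 1 - \<epsilon>" for n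
    using \<nu>.ex_interval_mass_gt[OF \<open>\<epsilon> > 0\<close>] by metis
  then obtain b where b: "\<And>n. b n > 0" "\<And>n. measure (\<nu> n) {-b n<..b n} > 1 - \<epsilon>"
    by metis
  define B where "B = 1 / s + (\<Sum>n<n0. b n)"
  have "0 \<le> (\<Sum>n<n0. b n)" using b by (intro sum_nonneg) (auto intro: less_imp_le)
  then have B: "1 / s \<le> B" "B > 0"
    using \<open>s > 0\<close> by (auto simp: B_def add_pos_nonneg)
  have "measure (\<nu> n) {-B<..B} > 1 - \<epsilon>" for n
  proof (cases "n < n0")
    case True
    then have "b n \<le> (\<Sum>n<n0. b n)"
      using b by (intro member_le_sum) (auto intro: less_imp_le)
    then have "b n \<le> B" using \<open>s > 0\<close> by (simp add: B_def add_increasing)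
    then have "measure (\<nu> n) {-b n<..b n} \<le> measure (\<nu> n) {-B<..B}"
      by (intro \<nu>.finite_measure_mono) auto
    then show ?thesis using b(2)[of n] by linarith
  next
    case False
    have "measure (\<nu> n) (UNIV - {x. 1 / s \<le> \<bar>x\<bar>}) \<le> measure (\<nu> n) {-B<..B}"
      using B by (intro \<nu>.finite_measure_mono) auto
    moreover have "measure (\<nu> n) (UNIV - {x. 1 / s \<le> \<bar>x\<bar>}) = 1 - measure (\<nu> n) {x. 1 / s \<le> \<bar>x\<bar>}"
      using \<nu>.prob_compl[of "{x. 1 / s \<le> \<bar>x\<bar>}" n] by simp
    moreover have "measure (\<nu> n) {x. 1 / s \<le> \<bar>x\<bar>} < \<epsilon>"
      using \<nu>.tail_le_char[OF \<open>s > 0\<close>, of n] n0[of n] False by (simp add: R_def)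
    ultimately show ?thesis by linarith
  qed
  then show "\<exists>a b. a < b \<and> (\<forall>n. 1 - \<epsilon> < measure (\<nu> n) {a<..b})"
    using B by (intro exI[of _ "-B"] exI[of _ B]) auto
qed (rule \<nu>)

text \<open>The continuity theorem in the form that produces the limit law instead of presupposing it.\<close>
lemma limit_of_char_is_char:
  assumes \<nu>: "\<And>n. real_distribution (\<nu> n)"
    and lim: "\<And>\<theta>. (\<lambda>n. char (\<nu> n) \<theta>) \<longlonglongrightarrow> \<xi> \<theta>" and cont: "isCont \<xi> 0"
  obtains \<rho> where "real_distribution \<rho>" "char \<rho> = \<xi>"
proof -
  obtain r \<rho> where r: "strict_mono r" "real_distribution \<rho>" "weak_conv_m (\<nu> \<circ> id \<circ> r) \<rho>"
    using tight_imp_convergent_subsubsequence[OF tight_if_char_tendsto[OF assms], of id]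
    by (auto simp: strict_mono_def)
  have "char \<rho> \<theta> = \<xi> \<theta>" for \<theta>
  proof (rule LIMSEQ_unique)
    show "(\<lambda>n. char ((\<nu> \<circ> id \<circ> r) n) \<theta>) \<longlonglongrightarrow> char \<rho> \<theta>"
      using \<nu> by (intro levy_continuity1 r) auto
    show "(\<lambda>n. char ((\<nu> \<circ> id \<circ> r) n) \<theta>) \<longlonglongrightarrow> \<xi> \<theta>"
      using LIMSEQ_subseq_LIMSEQ[OF lim r(1)] by (simp add: o_def)
  qed
  with r show ?thesis by (intro that[of \<rho>]) auto
qed

text \<open>For \<open>w = k / m\<close> take the \<open>k\<close>-fold convolution of the \<open>m\<close>-th root; a real \<open>w\<close> is the limit of the
  rationals \<open>\<lfloor>w * m\<rfloor> / m\<close>, and the limit of the characteristic functions is continuous at 0.\<close>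
lemma infinitely_divisible_exp_scaled:
  assumes id: "infinitely_divisible \<mu>" and "0 \<le> w"
  obtains \<rho> where "real_distribution \<rho>" "\<And>\<theta>. char \<rho> \<theta> = exp (of_real w * dist_log (char \<mu>) \<theta>)"
proof -
  define \<psi> where "\<psi> = dist_log (char \<mu>)"
  note \<psi> = dist_log_char[OF id, folded \<psi>_def]
  have "\<exists>\<rho>. real_distribution \<rho> \<and> (\<forall>\<theta>. char \<rho> \<theta> = exp (of_real (real k / real (Suc m)) * \<psi> \<theta>))"
    for k m :: nat
  proof -
    obtain \<nu> where \<nu>: "real_distribution \<nu>" "\<And>\<theta>. char \<mu> \<theta> = char \<nu> \<theta> ^ Suc m"
      using infinitely_divisible_root[OF id, of "Suc m"] by auto
    interpret \<nu>: real_distribution \<nu> by fact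
    have "char \<nu> \<theta> = exp (\<psi> \<theta> / of_nat (Suc m))" for \<theta>
    proof (rule root_eq_exp[where m="Suc m"])
      show "continuous_on UNIV (char \<nu>)"
        by (simp add: \<nu>.isCont_char continuous_at_imp_continuous_on)
      show "continuous_on UNIV (\<lambda>\<theta>. \<psi> \<theta> / of_nat (Suc m))"
        by (intro continuous_intros \<psi>(1)) (simp del: of_nat_Suc)
      show "char \<nu> \<theta> ^ Suc m = exp (of_nat (Suc m) * (\<psi> \<theta> / of_nat (Suc m)))" for \<theta>
        unfolding \<nu>(2)[symmetric] \<psi>(3)[symmetric] by (simp del: of_nat_Suc)
    qed (auto simp: \<nu>.char_zero \<psi>(2))
    then have "char \<nu> \<theta> ^ k = exp (of_real (real k / real (Suc m)) * \<psi> \<theta>)" for \<theta>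
      by (simp add: exp_of_nat_mult[symmetric])
    then show ?thesis
      using char_distr_PiM_sum[of "{1..k}" "\<lambda>_. \<nu>"] \<nu>(1)
      by (intro exI[of _ "distr (PiM {1..k} (\<lambda>_. \<nu>)) borel (\<lambda>x. \<Sum>i\<in>{1..k}. x i)"]) auto
  qed
  then obtain \<nu> where \<nu>: "\<And>k m. real_distribution (\<nu> k m)"
    "\<And>k m \<theta>. char (\<nu> k m) \<theta> = exp (of_real (real k / real (Suc m)) * \<psi> \<theta>)"
    by metis
  define q where "q m = real (nat \<lfloor>w * real (Suc m)\<rfloor>) / real (Suc m)" for m
  have "q \<longlonglongrightarrow> w"
  proof (rule tendsto_sandwich)
    show "\<forall>\<^sub>F m in sequentially. w - 1 / Suc m \<le> q m"
    proof (rule always_eventually, rule allI)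
      fix m
      have "w * Suc m - 1 \<le> nat \<lfloor>w * real (Suc m)\<rfloor>" by linarith
      then have "(w * Suc m - 1) / Suc m \<le> q m" unfolding q_def by (rule divide_right_mono) simp
      then show "w - 1 / Suc m \<le> q m" by (simp add: diff_divide_distrib del: of_nat_Suc)
    qed
    show "\<forall>\<^sub>F m in sequentially. q m \<le> w"
    proof (rule always_eventually, rule allI)
      fix m
      have "0 \<le> w * real (Suc m)" using \<open>0 \<le> w\<close> by simp
      then have "nat \<lfloor>w * real (Suc m)\<rfloor> \<le> w * Suc m" by linarith
      then show "q m \<le> w" unfolding q_def by (simp add: divide_le_eq del: of_nat_Suc)
    qed
    have "(\<lambda>m. w - 1 / Suc m) \<longlonglongrightarrow> w - 0"
      by (intro tendsto_intros LIMSEQ_Suc[OF lim_1_over_n])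
    then show "(\<lambda>m. w - 1 / Suc m) \<longlonglongrightarrow> w" by simp
  qed simp
  then have "(\<lambda>m. char (\<nu> (nat \<lfloor>w * real (Suc m)\<rfloor>) m) \<theta>) \<longlonglongrightarrow> exp (of_real w * \<psi> \<theta>)" for \<theta>
    unfolding \<nu>(2) q_def[symmetric] by (intro tendsto_intros)
  moreover have "isCont (\<lambda>\<theta>. exp (of_real w * \<psi> \<theta>)) 0"
    using \<psi>(1) by (auto intro!: continuous_intros simp: continuous_on_eq_continuous_at)
  ultimately obtain \<rho> where "real_distribution \<rho>" "char \<rho> = (\<lambda>\<theta>. exp (of_real w * \<psi> \<theta>))"
    by (rule limit_of_char_is_char[where \<nu>="\<lambda>m. \<nu> (nat \<lfloor>w * real (Suc m)\<rfloor>) m", OF \<nu>(1)])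
  then show ?thesis
    using that by (simp add: \<psi>_def)
qed
section \<open>Laws on \<open>\<real>\<^sup>n\<close> and their characteristic functions\<close>

text \<open>One-dimensional uniqueness, in the presence of a nonnegative weight that carries information about
  other coordinates.\<close>
lemma weighted_char_determines_law:
  assumes "prob_space M" "prob_space N"
    and [measurable]: "X \<in> borel_measurable M" "Y \<in> borel_measurable N"
      "V \<in> borel_measurable M" "W \<in> borel_measurable N" "A \<in> sets borel"
    and V: "\<And>x. 0 \<le> V x" "\<And>x. V x \<le> c" and W: "\<And>x. 0 \<le> W x" "\<And>x. W x \<le> c"
    and eq: "\<And>\<theta>. (LINT x|M. complex_of_real (V x) * iexp (\<theta> * X x))
                 = (LINT x|N. complex_of_real (W x) * iexp (\<theta> * Y x))"
  shows "(LINT x|M. V x * indicator A (X x)) = (LINT x|N. W x * indicator A (Y x))"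
proof -
  interpret M: prob_space M by fact
  interpret N: prob_space N by fact
  have iV: "integrable M V" and iW: "integrable N W"
    using V W by (auto intro!: M.integrable_const_bound[where B=c] N.integrable_const_bound[where B=c])
  define m where "m = (LINT x|M. V x)"
  have m: "m = (LINT x|N. W x)"
    using eq[of 0] by (simp add: m_def del: of_real_eq_iff flip: of_real_eq_iff[where 'a=complex])
  show ?thesis
  proof (cases "m = 0")
    case True
    then have "AE x in M. V x = 0" "AE x in N. W x = 0"
      using integral_nonneg_eq_0_iff_AE[OF iV] integral_nonneg_eq_0_iff_AE[OF iW] V W m
      by (auto simp: m_def)
    then have "AE x in M. V x * indicator A (X x) = 0" "AE x in N. W x * indicator A (Y x) = 0"
      by auto
    then show ?thesis by (simp add: integral_eq_zero_AE)
  next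
    case False
    have "0 \<le> m" using V by (simp add: m_def)
    with False have "m > 0" by simp
    \<comment> \<open>Normalising the weights turns both sides into laws on the line.\<close>
    define L1 where "L1 = distr (density M (\<lambda>x. ennreal (V x / m))) borel X"
    define L2 where "L2 = distr (density N (\<lambda>x. ennreal (W x / m))) borel Y"
    have "(\<integral>\<^sup>+x. ennreal (V x / m) \<partial>M) = ennreal (LINT x|M. V x / m)"
      using V iV \<open>m > 0\<close> by (intro nn_integral_eq_integral) auto
    then have p1: "prob_space (density M (\<lambda>x. ennreal (V x / m)))"
      using \<open>m > 0\<close> by (intro prob_spaceI) (simp add: emeasure_density m_def)
    have "(\<integral>\<^sup>+x. ennreal (W x / m) \<partial>N) = ennreal (LINT x|N. W x / m)"
      using W iW \<open>m > 0\<close> by (intro nn_integral_eq_integral) auto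
    then have p2: "prob_space (density N (\<lambda>x. ennreal (W x / m)))"
      using \<open>m > 0\<close> by (intro prob_spaceI) (simp add: emeasure_density m)
    have r1: "real_distribution L1" and r2: "real_distribution L2"
      unfolding L1_def L2_def
      by (auto intro!: prob_space.real_distribution_distr p1 p2)
    have i1: "(LINT x|L1. f x) = (LINT x|M. (V x / m) *\<^sub>R f (X x))"
      and i2: "(LINT x|L2. f x) = (LINT x|N. (W x / m) *\<^sub>R f (Y x))"
      if [measurable]: "f \<in> borel_measurable borel"
      for f :: "real \<Rightarrow> 'z :: {banach, second_countable_topology}"
      unfolding L1_def L2_def using V W \<open>m > 0\<close>
      by (simp_all add: integral_distr integral_density)
    have "char L1 = char L2"
    proof
      fix \<theta>
      have "char L1 \<theta> = (LINT x|M. complex_of_real (V x) * iexp (\<theta> * X x)) / m"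
        unfolding char_def by (subst i1) (auto simp: scaleR_conv_of_real)
      also have "\<dots> = char L2 \<theta>"
        unfolding eq char_def by (subst i2) (auto simp: scaleR_conv_of_real)
      finally show "char L1 \<theta> = char L2 \<theta>" .
    qed
    then have "L1 = L2"
      by (intro Levy_uniqueness r1 r2)
    then have "(LINT x|M. (V x / m) *\<^sub>R indicator A (X x)) = (LINT x|N. (W x / m) *\<^sub>R indicator A (Y x) :: real)"
      using i1[of "indicator A :: real \<Rightarrow> real"] i2[of "indicator A :: real \<Rightarrow> real"] by simp
    then have "(LINT x|M. V x * indicator A (X x)) / m = (LINT x|N. W x * indicator A (Y x)) / m"
      by simp
    with \<open>m > 0\<close> show ?thesis by simp
  qed
qed

text \<open>This exchanges one coordinate of the Fourier transform for an indicator. The factor \<open>iexp (S x)\<close>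
  cannot serve as a weight because it is complex, but \<open>1 + Re (z * iexp (S x))\<close> is nonnegative, and the
  choices \<open>z = 1\<close> and \<open>z = - \<i>\<close> recover its real and imaginary part. The hypothesis is needed for
  all multiples \<open>b * S x\<close> since \<open>Re\<close> also brings in the conjugate character, which is \<open>b = - 1\<close>,
  and the constant 1, which is \<open>b = 0\<close>.\<close>
lemma char_determines_one_coordinate:
  assumes "prob_space M" "prob_space N"
    and [measurable]: "X \<in> borel_measurable M" "S \<in> borel_measurable M" "U \<in> borel_measurable M"
      "Y \<in> borel_measurable N" "T \<in> borel_measurable N" "W \<in> borel_measurable N" "A \<in> sets borel"
    and U: "\<And>x. 0 \<le> U x" "\<And>x. U x \<le> 1" and W: "\<And>x. 0 \<le> W x" "\<And>x. W x \<le> 1"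
    and eq: "\<And>a b. (LINT x|M. complex_of_real (U x) * iexp (a * X x + b * S x))
                  = (LINT x|N. complex_of_real (W x) * iexp (a * Y x + b * T x))"
  shows "(LINT x|M. complex_of_real (U x * indicator A (X x)) * iexp (S x))
       = (LINT x|N. complex_of_real (W x * indicator A (Y x)) * iexp (T x))"
proof -
  interpret M: prob_space M by fact
  interpret N: prob_space N by fact
  have bM: "integrable M f" if "f \<in> borel_measurable M" "\<And>x. norm (f x) \<le> 1"
    for f :: "_ \<Rightarrow> 'z::{banach, second_countable_topology}"
    using that by (auto intro!: M.integrable_const_bound[where B=1])
  have bN: "integrable N f" if "f \<in> borel_measurable N" "\<And>x. norm (f x) \<le> 1"
    for f :: "_ \<Rightarrow> 'z::{banach, second_countable_topology}"
    using that by (auto intro!: N.integrable_const_bound[where B=1])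
  have le1: "\<bar>u * v\<bar> \<le> 1" if "0 \<le> u" "u \<le> 1" "\<bar>v\<bar> \<le> 1" for u v :: real
    using that mult_mono[of "\<bar>u\<bar>" 1 "\<bar>v\<bar>" 1] by (simp add: abs_mult)
  have iM: "integrable M (\<lambda>x. complex_of_real (U x) * iexp (a * X x + b * S x))" for a b
    using U by (intro bM) (auto simp: norm_mult)
  have iN: "integrable N (\<lambda>x. complex_of_real (W x) * iexp (a * Y x + b * T x))" for a b
    using W by (intro bN) (auto simp: norm_mult)
  \<comment> \<open>Shifting by 1 makes the real and imaginary parts of the character into admissible weights.\<close>
  have weight: "(LINT x|M. U x * (1 + Re (z * iexp (S x))) * indicator A (X x))
      = (LINT x|N. W x * (1 + Re (z * iexp (T x))) * indicator A (Y x))" if z: "cmod z = 1" for z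
  proof (rule weighted_char_determines_law[where c=2, OF assms(1,2)])
    have r: "\<bar>Re (z * iexp y)\<bar> \<le> 1" for y
      using abs_Re_le_cmod[of "z * iexp y"] z by (simp add: norm_mult)
    have "0 \<le> u * (1 + Re (z * iexp y)) \<and> u * (1 + Re (z * iexp y)) \<le> 2" if "0 \<le> u" "u \<le> 1" for u y
      using r[of y] that mult_mono[of u 1 "1 + Re (z * iexp y)" 2]
      by (auto intro!: mult_nonneg_nonneg)
    then show "0 \<le> U x * (1 + Re (z * iexp (S x)))" "U x * (1 + Re (z * iexp (S x))) \<le> 2"
      "0 \<le> W y * (1 + Re (z * iexp (T y)))" "W y * (1 + Re (z * iexp (T y))) \<le> 2" for x y
      using U W by blast+
    fix \<theta>
    have expand: "complex_of_real (u * (1 + Re (z * iexp s))) * iexp (\<theta> * x)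
      = of_real u * iexp (\<theta> * x + 0 * s)
        + (z / 2) * (of_real u * iexp (\<theta> * x + 1 * s))
        + (cnj z / 2) * (of_real u * iexp (\<theta> * x + (-1) * s))" for u s x
    proof -
      have re: "complex_of_real (Re (z * iexp s)) = (z * iexp s + cnj z * iexp (- s)) / 2"
        using complex_add_cnj[of "z * iexp s"] by (simp add: exp_cnj)
      have ex: "iexp (\<theta> * x + 0 * s) = iexp (\<theta> * x)"
        "iexp (\<theta> * x + 1 * s) = iexp (\<theta> * x) * iexp s"
        "iexp (\<theta> * x + (-1) * s) = iexp (\<theta> * x) * iexp (- s)"
        by (simp_all add: exp_add[symmetric] algebra_simps)
      have "v * (1 + (z * f + y * g) / 2) * e = v * e + z / 2 * (v * (e * f)) + y / 2 * (v * (e * g))"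
        for v f g e y :: complex
        by (simp add: field_simps)
      then show ?thesis
        unfolding ex by (simp only: of_real_mult of_real_add re of_real_1)
    qed
    show "(LINT x|M. complex_of_real (U x * (1 + Re (z * iexp (S x)))) * iexp (\<theta> * X x))
        = (LINT x|N. complex_of_real (W x * (1 + Re (z * iexp (T x)))) * iexp (\<theta> * Y x))"
      unfolding expand
      using iM[of \<theta> 0] iM[of \<theta> 1] iM[of \<theta> "-1"] iN[of \<theta> 0] iN[of \<theta> 1] iN[of \<theta> "-1"]
        eq[of \<theta> 0] eq[of \<theta> 1] eq[of \<theta> "-1"]
      by (simp del: mult_minus_left mult_1 mult_zero_left)
  qed measurable
  have base: "(LINT x|M. U x * indicator A (X x)) = (LINT x|N. W x * indicator A (Y x))"
    using U W eq[of _ 0]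
    by (intro weighted_char_determines_law[where c=1, OF assms(1,2)]) auto
  have split: "complex_of_real (u * indicator A x) * iexp s
      = of_real (u * (1 + Re (1 * iexp s)) * indicator A x - u * indicator A x)
        + \<i> * of_real (u * (1 + Re (- \<i> * iexp s)) * indicator A x - u * indicator A x)" for u s x
    by (simp add: complex_eq_iff algebra_simps)
  have iM': "integrable M (\<lambda>x. U x * indicator A (X x))"
      "cmod z = 1 \<Longrightarrow> integrable M (\<lambda>x. U x * (1 + Re (z * iexp (S x))) * indicator A (X x))" for z
  proof -
    show int: "integrable M (\<lambda>x. U x * indicator A (X x))"
      using U le1 by (intro bM) (auto simp: indicator_def)
    assume z: "cmod z = 1"
    have re: "\<bar>Re (z * iexp y)\<bar> \<le> 1" for y
      using abs_Re_le_cmod[of "z * iexp y"] z by (simp add: norm_mult)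
    have "integrable M (\<lambda>x. (U x * indicator A (X x)) * Re (z * iexp (S x)))"
      by (intro bM, measurable, unfold real_norm_def, intro le1 re) (auto simp: indicator_def U)
    then have "integrable M (\<lambda>x. U x * indicator A (X x) + (U x * indicator A (X x)) * Re (z * iexp (S x)))"
      by (rule Bochner_Integration.integrable_add[OF int])
    then show "integrable M (\<lambda>x. U x * (1 + Re (z * iexp (S x))) * indicator A (X x))"
      by (simp add: algebra_simps)
  qed
  have iN': "integrable N (\<lambda>x. W x * indicator A (Y x))"
      "cmod z = 1 \<Longrightarrow> integrable N (\<lambda>x. W x * (1 + Re (z * iexp (T x))) * indicator A (Y x))" for z
  proof -
    show int: "integrable N (\<lambda>x. W x * indicator A (Y x))"
      using W le1 by (intro bN) (auto simp: indicator_def)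
    assume z: "cmod z = 1"
    have re: "\<bar>Re (z * iexp y)\<bar> \<le> 1" for y
      using abs_Re_le_cmod[of "z * iexp y"] z by (simp add: norm_mult)
    have "integrable N (\<lambda>x. (W x * indicator A (Y x)) * Re (z * iexp (T x)))"
      by (intro bN, measurable, unfold real_norm_def, intro le1 re) (auto simp: indicator_def W)
    then have "integrable N (\<lambda>x. W x * indicator A (Y x) + (W x * indicator A (Y x)) * Re (z * iexp (T x)))"
      by (rule Bochner_Integration.integrable_add[OF int])
    then show "integrable N (\<lambda>x. W x * (1 + Re (z * iexp (T x))) * indicator A (Y x))"
      by (simp add: algebra_simps)
  qed
  show ?thesis
    unfolding split
    using iM'(1) iM'(2)[of 1] iM'(2)[of "-\<i>"] iN'(1) iN'(2)[of 1] iN'(2)[of "-\<i>"]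
      weight[of 1] weight[of "-\<i>"] base
    by (simp del: mult_minus_left mult_1 of_real_diff of_real_mult)
qed

text \<open>Exchanging the coordinates one after the other for indicators turns equality of the characteristic
  functions into equality of the laws on boxes.\<close>
lemma prob_law_eqI:
  assumes "prob_law n \<mu>" "prob_law n \<nu>" and char: "\<And>\<theta>. char_vec n \<mu> \<theta> = char_vec n \<nu> \<theta>"
  shows "\<mu> = \<nu>"
proof -
  have M: "prob_space \<mu>" "prob_space \<nu>" and S[measurable_cong]: "sets \<mu> = sets (Rn n)" "sets \<nu> = sets (Rn n)"
    using assms by (auto simp: prob_law_def)
  interpret M: prob_space \<mu> by fact
  interpret N: prob_space \<nu> by fact
  have partial: "(LINT x|\<mu>. complex_of_real (\<Prod>j=1..k. indicator (B j) (x j)) * iexp (\<Sum>j=Suc k..n. \<theta> j * x j))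
      = (LINT x|\<nu>. complex_of_real (\<Prod>j=1..k. indicator (B j) (x j)) * iexp (\<Sum>j=Suc k..n. \<theta> j * x j))"
    if "k \<le> n" and B: "\<And>j. B j \<in> sets borel" for k \<theta> and B :: "nat \<Rightarrow> real set"
    using \<open>k \<le> n\<close>
  proof (induction k arbitrary: \<theta>)
    case 0
    then show ?case using char[of \<theta>] by (simp add: char_vec_def)
  next
    case (Suc k)
    note B[measurable]
    have [measurable]: "(\<lambda>x. x j) \<in> borel_measurable (Rn n)" if "j \<in> {1..n}" for j
      using that by simp
    have k: "Suc k \<in> {1..n}" using Suc.prems by simp
    have sum_split: "(\<Sum>j=Suc k..n. (if j = Suc k then a else b * \<theta> j) * x j)
        = a * x (Suc k) + b * (\<Sum>j=Suc (Suc k)..n. \<theta> j * x j)" for a b and x :: "nat \<Rightarrow> real"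
    proof -
      have "(\<Sum>j=Suc (Suc k)..n. (if j = Suc k then a else b * \<theta> j) * x j)
          = (\<Sum>j=Suc (Suc k)..n. b * (\<theta> j * x j))"
        by (intro sum.cong) auto
      then show ?thesis
        using Suc.prems by (subst sum.atLeast_Suc_atMost) (auto simp: sum_distrib_left)
    qed
    have "(LINT x|\<mu>. complex_of_real ((\<Prod>j=1..k. indicator (B j) (x j)) * indicator (B (Suc k)) (x (Suc k)))
          * iexp (\<Sum>j=Suc (Suc k)..n. \<theta> j * x j))
      = (LINT x|\<nu>. complex_of_real ((\<Prod>j=1..k. indicator (B j) (x j)) * indicator (B (Suc k)) (x (Suc k)))
          * iexp (\<Sum>j=Suc (Suc k)..n. \<theta> j * x j))"
    proof (rule char_determines_one_coordinate[OF M])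
      show "(\<lambda>x. x (Suc k)) \<in> borel_measurable \<mu>" "(\<lambda>x. x (Suc k)) \<in> borel_measurable \<nu>"
        using k by measurable
      show "(\<lambda>x. \<Sum>j=Suc (Suc k)..n. \<theta> j * x j) \<in> borel_measurable \<mu>"
        "(\<lambda>x. \<Sum>j=Suc (Suc k)..n. \<theta> j * x j) \<in> borel_measurable \<nu>"
        by (intro borel_measurable_sum borel_measurable_times measurable_const; measurable)+
      show "(\<lambda>x. \<Prod>j=1..k. indicator (B j) (x j) :: real) \<in> borel_measurable \<mu>"
        "(\<lambda>x. \<Prod>j=1..k. indicator (B j) (x j) :: real) \<in> borel_measurable \<nu>"
        using Suc.prems by (intro borel_measurable_prod; measurable)+
      show "(LINT x|\<mu>. complex_of_real (\<Prod>j=1..k. indicator (B j) (x j)) *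
            iexp (a * x (Suc k) + b * (\<Sum>j=Suc (Suc k)..n. \<theta> j * x j)))
        = (LINT x|\<nu>. complex_of_real (\<Prod>j=1..k. indicator (B j) (x j)) *
            iexp (a * x (Suc k) + b * (\<Sum>j=Suc (Suc k)..n. \<theta> j * x j)))" for a b
        unfolding sum_split[symmetric] using Suc by (intro Suc.IH) simp
    qed (auto intro!: prod_nonneg prod_le_1 simp: B)
    then show ?case by simp
  qed
  show ?thesis
  proof (rule measure_eqI_PiM_finite)
    show "sets \<mu> = sets (Rn n)" "sets \<nu> = sets (Rn n)" by (rule S)+
    show "emeasure \<mu> (Pi\<^sub>E {1..n} A) = emeasure \<nu> (Pi\<^sub>E {1..n} A)"
      if "\<And>i. i \<in> {1..n} \<Longrightarrow> A i \<in> sets borel" for A :: "nat \<Rightarrow> real set"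
    proof -
      define B where "B j = (if j \<in> {1..n} then A j else {})" for j
      have B: "B j \<in> sets borel" for j using that by (simp add: B_def)
      have box: "Pi\<^sub>E {1..n} A \<in> sets (Rn n)" using that by (intro sets_PiM_I_finite) auto
      have ind: "(\<Prod>j=1..n. indicator (B j) (x j) :: real) = indicator (Pi\<^sub>E {1..n} A) x"
        if "x \<in> space (Rn n)" for x
      proof (cases "x \<in> Pi\<^sub>E {1..n} A")
        case True
        then show ?thesis by (auto simp: B_def PiE_iff intro!: prod.neutral)
      next
        case False
        then obtain j where "j \<in> {1..n}" "x j \<notin> A j"
          using \<open>x \<in> space (Rn n)\<close> by (auto simp: space_PiM PiE_iff)
        then show ?thesis using False by (auto simp: B_def intro!: prod_zero bexI[of _ j])
      qed
      have sp: "space \<mu> = space (Rn n)" "space \<nu> = space (Rn n)"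
        using S by (auto dest: sets_eq_imp_space_eq)
      have "(LINT x|\<mu>. complex_of_real (\<Prod>j=1..n. indicator (B j) (x j)))
          = (LINT x|\<nu>. complex_of_real (\<Prod>j=1..n. indicator (B j) (x j)))"
        using partial[of n B, OF _ B] by simp
      also have "(LINT x|\<mu>. complex_of_real (\<Prod>j=1..n. indicator (B j) (x j)))
          = (LINT x|\<mu>. complex_of_real (indicator (Pi\<^sub>E {1..n} A) x))"
        by (rule Bochner_Integration.integral_cong) (simp_all only: sp ind)
      also have "(LINT x|\<nu>. complex_of_real (\<Prod>j=1..n. indicator (B j) (x j)))
          = (LINT x|\<nu>. complex_of_real (indicator (Pi\<^sub>E {1..n} A) x))"
        by (rule Bochner_Integration.integral_cong) (simp_all only: sp ind)
      finally have "measure \<mu> (Pi\<^sub>E {1..n} A \<inter> space \<mu>) = measure \<nu> (Pi\<^sub>E {1..n} A \<inter> space \<nu>)"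
        by simp
      moreover have "Pi\<^sub>E {1..n} A \<inter> space \<mu> = Pi\<^sub>E {1..n} A" "Pi\<^sub>E {1..n} A \<inter> space \<nu> = Pi\<^sub>E {1..n} A"
        using sets.sets_into_space[OF box] sp by auto
      ultimately have "measure \<mu> (Pi\<^sub>E {1..n} A) = measure \<nu> (Pi\<^sub>E {1..n} A)"
        by simp
      then show ?thesis
        by (simp add: M.emeasure_eq_measure N.emeasure_eq_measure)
    qed
    show "range (\<lambda>_::nat. space (Rn n)) \<subseteq> prod_algebra {1..n} (\<lambda>_. borel)"
      by (auto intro!: prod_algebraI_finite simp: space_PiM)
  qed (auto)
qed

lemma char_vec_distr_PiM_sum:
  fixes m :: nat
  assumes "prob_law n \<nu>"
  defines "\<rho> \<equiv> distr (\<Pi>\<^sub>M j\<in>{1..m}. \<nu>) (Rn n) (\<lambda>x. \<lambda>k\<in>{1..n}. \<Sum>j=1..m. x j k)"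
  shows "prob_law n \<rho>" and "char_vec n \<rho> \<theta> = char_vec n \<nu> \<theta> ^ m"
proof -
  have P: "prob_space \<nu>" and S[measurable_cong]: "sets \<nu> = sets (Rn n)"
    using assms by (auto simp: prob_law_def)
  have comp: "(\<lambda>y. y k) \<in> borel_measurable \<nu>" if "k \<in> {1..n}" for k
    using that by measurable
  have "(\<lambda>x. x j k) \<in> borel_measurable (\<Pi>\<^sub>M j\<in>{1..m}. \<nu>)" if "j \<in> {1..m}" "k \<in> {1..n}" for j k
    by (rule measurable_compose[where g="\<lambda>y. y k", OF measurable_component_singleton[OF that(1)] comp[OF that(2)]])
  then have sum: "(\<lambda>x. \<lambda>k\<in>{1..n}. \<Sum>j=1..m. x j k) \<in> (\<Pi>\<^sub>M j\<in>{1..m}. \<nu>) \<rightarrow>\<^sub>M Rn n"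
    by (intro measurable_restrict borel_measurable_sum) auto
  show "prob_law n \<rho>"
    unfolding prob_law_def \<rho>_def
    using prob_space.prob_space_distr[OF prob_space_PiM[OF P] sum] by simp
  have "char_vec n \<rho> \<theta> = (LINT x|(\<Pi>\<^sub>M j\<in>{1..m}. \<nu>). iexp (\<Sum>k=1..n. \<theta> k * (\<Sum>j=1..m. x j k)))"
    unfolding char_vec_def \<rho>_def
    by (subst integral_distr[OF sum]) (auto intro!: borel_measurable_sum)
  also have "\<dots> = (LINT x|(\<Pi>\<^sub>M j\<in>{1..m}. \<nu>). iexp (\<Sum>j=1..m. \<Sum>k=1..n. \<theta> k * x j k))"
    by (subst sum.swap) (simp add: sum_distrib_left)
  also have "\<dots> = (\<Prod>j\<in>{1..m}. LINT y|\<nu>. iexp (\<Sum>k=1..n. \<theta> k * y k))"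
    by (rule integral_iexp_sum_PiM[OF _ P, of "{1..m}" "\<lambda>_ y. \<Sum>k=1..n. \<theta> k * y k"])
       (auto intro!: borel_measurable_sum)
  finally show "char_vec n \<rho> \<theta> = char_vec n \<nu> \<theta> ^ m"
    by (simp add: char_vec_def)
qed

lemma infinitely_divisible_vecI:
  assumes "prob_law n \<mu>"
    and "\<And>m::nat. 1 \<le> m \<Longrightarrow> \<exists>\<nu>. prob_law n \<nu> \<and> (\<forall>\<theta>. char_vec n \<nu> \<theta> ^ m = char_vec n \<mu> \<theta>)"
  shows "infinitely_divisible_vec n \<mu>"
  unfolding infinitely_divisible_vec_def
proof (intro conjI allI impI)
  fix m :: nat assume "1 \<le> m"
  then obtain \<nu> where "prob_law n \<nu>" "\<And>\<theta>. char_vec n \<nu> \<theta> ^ m = char_vec n \<mu> \<theta>"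
    using assms(2) by blast
  then show "\<exists>\<nu>. prob_law n \<nu> \<and>
      \<mu> = distr (\<Pi>\<^sub>M j\<in>{1..m}. \<nu>) (Rn n) (\<lambda>x. \<lambda>k\<in>{1..n}. \<Sum>j=1..m. x j k)"
    using char_vec_distr_PiM_sum assms(1) by (intro exI[of _ \<nu>] conjI prob_law_eqI) auto
qed (fact assms(1))

text \<open>One independent variable \<open>y (j, i)\<close> with exponent \<open>w i j * \<psi>\<close> per cell; the \<open>k\<close>-th coordinate of the
  vector adds up those with \<open>i \<le> k \<le> j\<close>, so that \<open>y (j, i)\<close> receives the coefficient
  \<open>\<theta> i + \<dots> + \<theta> j\<close>.\<close>
lemma ex_law_of_interval_sums:
  fixes \<psi> :: "real \<Rightarrow> complex" and w :: "nat \<Rightarrow> nat \<Rightarrow> real"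
  assumes \<psi>: "\<And>c. 0 \<le> c \<Longrightarrow> \<exists>\<rho>. real_distribution \<rho> \<and> (\<forall>\<theta>. char \<rho> \<theta> = exp (of_real c * \<psi> \<theta>))"
    and w: "\<And>i j. \<lbrakk>1 \<le> i; i \<le> j; j \<le> n\<rbrakk> \<Longrightarrow> 0 \<le> w i j"
  obtains \<mu> where "prob_law n \<mu>"
    "\<And>\<theta>. char_vec n \<mu> \<theta> = exp (\<Sum>j=1..n. \<Sum>i=1..j. \<psi> (\<Sum>k=i..j. \<theta> k) * of_real (w i j))"
proof -
  define I where "I = (SIGMA j:{1..n}. {1..j})"
  have "\<exists>\<rho>. real_distribution \<rho> \<and>
      (p \<in> I \<longrightarrow> (\<forall>\<theta>. char \<rho> \<theta> = exp (of_real (w (snd p) (fst p)) * \<psi> \<theta>)))" for p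
    using \<psi>[of "w (snd p) (fst p)"] \<psi>[of 0] w[of "snd p" "fst p"]
    by (cases "p \<in> I") (auto simp: I_def)
  then obtain N where N: "\<And>p. real_distribution (N p)"
    "\<And>p \<theta>. p \<in> I \<Longrightarrow> char (N p) \<theta> = exp (of_real (w (snd p) (fst p)) * \<psi> \<theta>)"
    by metis
  have P: "prob_space (N p)" and S[measurable_cong]: "sets (N p) = sets borel" for p
    using N(1)[of p] by (auto simp: real_distribution_def real_distribution_axioms_def)
  have "finite I" by (simp add: I_def)
  define V where "V y = (\<lambda>k\<in>{1..n}. \<Sum>p\<in>I. if k \<in> {snd p..fst p} then y p else (0::real))" for y
  have V: "V \<in> PiM I N \<rightarrow>\<^sub>M Rn n"
    unfolding V_def by (intro measurable_restrict borel_measurable_sum) auto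
  define \<mu> where "\<mu> = distr (PiM I N) (Rn n) V"
  show ?thesis
  proof
    show "prob_law n \<mu>"
      unfolding prob_law_def \<mu>_def
      using prob_space.prob_space_distr[OF prob_space_PiM[OF P] V] by simp
    fix \<theta>
    have swap: "(\<Sum>k=1..n. \<theta> k * V y k) = (\<Sum>p\<in>I. (\<Sum>k=snd p..fst p. \<theta> k) * y p)" for y
    proof -
      have "(\<Sum>k=1..n. \<theta> k * V y k) = (\<Sum>k=1..n. \<Sum>p\<in>I. if k \<in> {snd p..fst p} then \<theta> k * y p else 0)"
        by (auto simp: V_def sum_distrib_left intro!: sum.cong)
      also have "\<dots> = (\<Sum>p\<in>I. \<Sum>k=1..n. if k \<in> {snd p..fst p} then \<theta> k * y p else 0)"
        by (rule sum.swap)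
      also have "\<dots> = (\<Sum>p\<in>I. \<Sum>k=snd p..fst p. \<theta> k * y p)"
      proof (rule sum.cong[OF refl])
        fix p assume "p \<in> I"
        then have "{k \<in> {1..n}. k \<in> {snd p..fst p}} = {snd p..fst p}"
          by (auto simp: I_def)
        then show "(\<Sum>k=1..n. if k \<in> {snd p..fst p} then \<theta> k * y p else 0)
            = (\<Sum>k=snd p..fst p. \<theta> k * y p)"
          by (simp only: sum.inter_filter[symmetric] finite_atLeastAtMost)
      qed
      finally show ?thesis by (simp add: sum_distrib_right)
    qed
    have "char_vec n \<mu> \<theta> = (LINT y|PiM I N. iexp (\<Sum>k=1..n. \<theta> k * V y k))"
      unfolding char_vec_def \<mu>_def by (subst integral_distr[OF V]) (auto intro!: borel_measurable_sum)
    also have "\<dots> = (\<Prod>p\<in>I. char (N p) (\<Sum>k=snd p..fst p. \<theta> k))"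
      unfolding swap char_def
      using integral_iexp_sum_PiM[OF \<open>finite I\<close> P, of "\<lambda>p y. (\<Sum>k=snd p..fst p. \<theta> k) * y"] by simp
    also have "\<dots> = (\<Prod>p\<in>I. exp (\<psi> (\<Sum>k=snd p..fst p. \<theta> k) * of_real (w (snd p) (fst p))))"
      by (intro prod.cong) (auto simp: N(2) mult.commute)
    also have "\<dots> = exp (\<Sum>p\<in>I. \<psi> (\<Sum>k=snd p..fst p. \<theta> k) * of_real (w (snd p) (fst p)))"
      using \<open>finite I\<close> by (simp add: exp_sum)
    also have "(\<Sum>p\<in>I. \<psi> (\<Sum>k=snd p..fst p. \<theta> k) * of_real (w (snd p) (fst p)))
        = (\<Sum>j=1..n. \<Sum>i=1..j. \<psi> (\<Sum>k=i..j. \<theta> k) * of_real (w i j))"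
      unfolding I_def by (subst sum.Sigma) (auto simp: split_beta)
    finally show "char_vec n \<mu> \<theta> = exp (\<Sum>j=1..n. \<Sum>i=1..j. \<psi> (\<Sum>k=i..j. \<theta> k) * of_real (w i j))" .
  qed
qed

section \<open>Cell masses and refinement of the time grid\<close>

text \<open>The mass of the pairs that are alive at the times with index \<open>i, \<dots>, j\<close> and at no other.\<close>
definition fdd_weight :: "(real \<Rightarrow> real) \<Rightarrow> nat \<Rightarrow> (nat \<Rightarrow> real) \<Rightarrow> nat \<Rightarrow> nat \<Rightarrow> real" where
  "fdd_weight H n t i j = (let T = ext_time n t; G = ext_df H in
     G (T j - T (i - 1)) - G (T j - T i) - G (T (j + 1) - T (i - 1)) + G (T (j + 1) - T i))"

lemma fdd_log_char_eq_sum_weight: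
  "fdd_log_char \<psi> H n \<theta> t =
     (\<Sum>j=1..n. \<Sum>i=1..j. \<psi> (\<Sum>k=i..j. \<theta> k) * of_real (fdd_weight H n t i j))"
  by (simp add: fdd_log_char_def fdd_weight_def Let_def)

lemma ext_df_ext_time:
  "i \<le> j \<Longrightarrow> j \<le> Suc n \<Longrightarrow> 1 \<le> j \<Longrightarrow> i \<le> n \<Longrightarrow> ext_df H (ext_time n t j - ext_time n t i) =
    (if i = 0 \<or> j = Suc n then 1 else H (t j - t i))"
  by (auto simp: ext_df_def ext_time_def)

text \<open>Both inner points lie on the segment from \<open>a\<close> to \<open>a + d + e\<close>, at complementary ratios
  \<open>l = d / (d + e)\<close> and \<open>1 - l\<close>, so the two chord inequalities add up.\<close>
lemma concave_on_increments:
  assumes H: "concave_on {0..} H" and "0 \<le> a" "0 \<le> d" "0 \<le> e"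
  shows "H (a + d + e) + H a \<le> H (a + d) + H (a + (e::real))"
proof (cases "d + e = 0")
  case False
  then have pos: "d + e > 0" using assms by simp
  have chord: "(1 - l) * H a + l * H (a + d + e) \<le> H (a + l * (d + e))" if "0 \<le> l" "l \<le> 1" for l
  proof -
    have "(1 - l) * a + l * (a + d + e) = a + l * (d + e)" by (simp add: algebra_simps)
    with concave_onD[OF H that, of a "a + d + e"] assms show ?thesis by simp
  qed
  define l where "l = d / (d + e)"
  have l: "0 \<le> l" "l \<le> 1" "l * (d + e) = d" using assms pos by (auto simp: l_def)
  then have "(1 - l) * (d + e) = e" by (simp add: left_diff_distrib)
  with l chord[of l] chord[of "1 - l"]
  have "(1 - l) * H a + l * H (a + d + e) \<le> H (a + d)"
    "(1 - (1 - l)) * H a + (1 - l) * H (a + d + e) \<le> H (a + e)"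
    by auto
  moreover have "(1 - l) * H a + l * H (a + d + e) + ((1 - (1 - l)) * H a + (1 - l) * H (a + d + e))
      = H a + H (a + d + e)"
    by (simp add: algebra_simps)
  ultimately show ?thesis by linarith
next
  case True
  then have "d = 0" "e = 0" using assms by auto
  then show ?thesis by simp
qed

text \<open>Concavity is what makes the inner cells nonnegative; for cells with a side at infinity monotonicity of
  \<open>H\<close> is enough, and for the cell unbounded on both sides \<open>H \<le> 1\<close>.\<close>
lemma fdd_weight_nonneg:
  assumes H: "concave_on {0..} H" "mono H" "\<And>x. H x \<le> 1"
    and t: "ordered_times n t" and ij: "1 \<le> i" "i \<le> j" "j \<le> n"
  shows "0 \<le> fdd_weight H n t i j"
proof -
  have le: "t k \<le> t l" if "1 \<le> k" "k \<le> l" "l \<le> n" for k l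
    using monotone_onD[OF t, of k l] that by auto
  have w: "fdd_weight H n t i j =
      (if i = 1 then 1 else H (t j - t (i - 1))) - H (t j - t i)
      - (if i = 1 \<or> j = n then 1 else H (t (j + 1) - t (i - 1)))
      + (if j = n then 1 else H (t (j + 1) - t i))"
    unfolding fdd_weight_def Let_def using ij by (auto simp: ext_df_ext_time)
  consider "i = 1" "j = n" | "i = 1" "j < n" | "1 < i" "j = n" | "1 < i" "j < n"
    using ij by linarith
  then show ?thesis
  proof cases
    case 1
    then show ?thesis unfolding w using H(3) by simp
  next
    case 2
    then show ?thesis unfolding w using ij le[of j "j + 1"] monoD[OF H(2), of "t j - t i" "t (j + 1) - t i"]
      by simp
  next
    case 3
    then show ?thesis unfolding w using ij le[of "i - 1" i] monoD[OF H(2), of "t j - t i" "t j - t (i - 1)"]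
      by simp
  next
    case 4
    then show ?thesis unfolding w
      using ij le[of "i - 1" i] le[of j "j + 1"] le[of i j]
        concave_on_increments[OF H(1), of "t j - t i" "t i - t (i - 1)" "t (j + 1) - t j"]
      by (simp add: algebra_simps)
  qed
qed

lemma fdd_log_char_shift:
  "fdd_log_char \<psi> H n \<theta> (\<lambda>k. t k + h) = fdd_log_char \<psi> H n \<theta> t"
proof -
  have "ext_time n (\<lambda>k. t k + h) i = ext_time n t i + ereal h" for i
    by (simp add: ext_time_def)
  moreover have "(x + ereal h) - (y + ereal h) = x - y" for x y
    by (cases x; cases y) auto
  ultimately show ?thesis by (simp add: fdd_log_char_def Let_def)
qed

text \<open>The cells below the diagonal carry the empty sum of coefficients and contribute \<open>\<psi> 0 = 0\<close>. Summing
  over the full square makes the two indices independent, and shifting \<open>i\<close> by one lets both run over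
  the same gaps between consecutive times.\<close>
lemma fdd_log_char_eq_full_sum:
  assumes "\<psi> 0 = 0"
  shows "fdd_log_char \<psi> H n \<theta> t =
    (\<Sum>j<Suc n. \<Sum>i<Suc n. \<psi> (\<Sum>k=Suc i..j. \<theta> k) * of_real (fdd_weight H n t (Suc i) j))"
proof -
  have inner: "(\<Sum>i<Suc n. \<psi> (\<Sum>k=Suc i..j. \<theta> k) * of_real (fdd_weight H n t (Suc i) j))
      = (\<Sum>i=1..j. \<psi> (\<Sum>k=i..j. \<theta> k) * of_real (fdd_weight H n t i j))" if "j < Suc n" for j
    using that assms
    by (simp only: sum.atLeast1_atMost_eq One_nat_def, intro sum.mono_neutral_right) auto
  have "(\<Sum>j<Suc n. \<Sum>i<Suc n. \<psi> (\<Sum>k=Suc i..j. \<theta> k) * of_real (fdd_weight H n t (Suc i) j))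
      = (\<Sum>j<Suc n. \<Sum>i=1..j. \<psi> (\<Sum>k=i..j. \<theta> k) * of_real (fdd_weight H n t i j))"
    by (intro sum.cong refl inner) simp
  also have "\<dots> = (\<Sum>j=1..n. \<Sum>i=1..j. \<psi> (\<Sum>k=i..j. \<theta> k) * of_real (fdd_weight H n t i j))"
    by (rule sum.mono_neutral_right) (auto simp: not_le)
  finally show ?thesis by (simp add: fdd_log_char_eq_sum_weight)
qed

lemma sum_lessThan_blocks:
  fixes F :: "nat \<Rightarrow> nat" and h :: "nat \<Rightarrow> 'b :: comm_monoid_add"
  assumes "\<And>p. p < m \<Longrightarrow> F p \<le> F (Suc p)" and "F 0 = 0"
  shows "(\<Sum>i<F m. h i) = (\<Sum>p<m. \<Sum>i\<in>{F p..<F (Suc p)}. h i)"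
  using assms(1)
proof (induction m)
  case (Suc m)
  have "{..<F (Suc m)} = {..<F m} \<union> {F m..<F (Suc m)}"
    using Suc.prems[of m] by auto
  then have "(\<Sum>i<F (Suc m). h i) = (\<Sum>i<F m. h i) + (\<Sum>i\<in>{F m..<F (Suc m)}. h i)"
    by (simp add: sum.union_disjoint ivl_disj_int)
  with Suc show ?case by simp
qed (simp add: assms)

text \<open>The coarse grid \<open>s = t \<circ> f\<close> splits the cells of the fine grid \<open>t\<close> into blocks. On a block the
  coefficient is constant, since the new times carry the coefficient 0, and the fine masses telescope
  to the mass of the coarse cell. The map \<open>f\<close> may take a value several times: the blocks between repeated
  times are empty, in accordance with the vanishing mass of the corresponding cells.\<close>
lemma fdd_log_char_refine:
  assumes \<psi>: "\<psi> 0 = 0" and f: "mono_on {1..m} f" "f ` {1..m} \<subseteq> {1..n}"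
    and s: "\<And>k. k \<in> {1..m} \<Longrightarrow> s k = t (f k)"
  shows "fdd_log_char \<psi> H m \<theta> s = fdd_log_char \<psi> H n (\<lambda>k. \<Sum>l | l \<in> {1..m} \<and> f l = k. \<theta> l) t"
proof -
  \<comment> \<open>The values at 0 and \<open>Suc m\<close> place the times at infinity of both grids on top of each other.\<close>
  define F where "F k = (if k = 0 then 0 else if k \<le> m then f k else Suc n)" for k
  have f_range: "1 \<le> f k" "f k \<le> n" if "1 \<le> k" "k \<le> m" for k
    using f(2) that by (auto simp: image_subset_iff)
  have F_mono: "F k \<le> F l" if "k \<le> l" for k l
    using monotone_onD[OF f(1), of k l] f_range[of k] f_range[of l] that
    by (auto simp: F_def)
  have F_ends: "F 0 = 0" "F (Suc m) = Suc n" by (auto simp: F_def)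
  have T: "ext_time m s k = ext_time n t (F k)" if "k \<le> Suc m" for k
    using that s f_range[of k] by (auto simp: ext_time_def F_def)
  define g where "g a b = ext_df H (ext_time n t b - ext_time n t a)" for a b
  have weight: "fdd_weight H m s (Suc p) q = (\<Sum>j\<in>{F q..<F (Suc q)}. \<Sum>i\<in>{F p..<F (Suc p)}. fdd_weight H n t (Suc i) j)"
    if "p < Suc m" "q < Suc m" for p q
  proof -
    have "(\<Sum>i\<in>{F p..<F (Suc p)}. fdd_weight H n t (Suc i) j)
        = (\<Sum>i\<in>{F p..<F (Suc p)}. (- g (Suc i) j + g (Suc i) (Suc j)) - (- g i j + g i (Suc j)))" for j
      by (simp add: fdd_weight_def g_def Let_def algebra_simps)
    also have "\<dots> j = (g (F p) j - g (F (Suc p)) j) - (g (F p) (Suc j) - g (F (Suc p)) (Suc j))" for j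
      by (subst sum_Suc_diff') (auto intro: F_mono)
    finally have "(\<Sum>j\<in>{F q..<F (Suc q)}. \<Sum>i\<in>{F p..<F (Suc p)}. fdd_weight H n t (Suc i) j)
      = - (\<Sum>j\<in>{F q..<F (Suc q)}. (g (F p) (Suc j) - g (F (Suc p)) (Suc j)) - (g (F p) j - g (F (Suc p)) j))"
      by (simp add: sum_negf[symmetric])
    also have "\<dots> = - ((g (F p) (F (Suc q)) - g (F (Suc p)) (F (Suc q))) - (g (F p) (F q) - g (F (Suc p)) (F q)))"
      by (subst sum_Suc_diff') (auto intro: F_mono)
    also have "\<dots> = fdd_weight H m s (Suc p) q"
      using that by (simp add: fdd_weight_def g_def T Let_def)
    finally show ?thesis by simp
  qed
  define \<Theta> where "\<Theta> k = (\<Sum>l | l \<in> {1..m} \<and> f l = k. \<theta> l)" for k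
  have group: "(\<Sum>k=Suc i..j. \<Theta> k) = (\<Sum>l=Suc p..q. \<theta> l)"
    if "p < Suc m" "q < Suc m" "i \<in> {F p..<F (Suc p)}" "j \<in> {F q..<F (Suc q)}" for i j p q
  proof -
    have "l \<in> {Suc p..q} \<longleftrightarrow> l \<in> {1..m} \<and> Suc i \<le> f l \<and> f l \<le> j" for l
    proof (cases "l \<in> {1..m}")
      case True
      then have fl: "f l = F l" by (auto simp: F_def)
      have "Suc p \<le> l \<longleftrightarrow> Suc i \<le> F l"
        using that F_mono[of "Suc p" l] F_mono[of l p] by (cases "Suc p \<le> l") auto
      moreover have "l \<le> q \<longleftrightarrow> F l \<le> j"
        using that F_mono[of l q] F_mono[of "Suc q" l] by (cases "l \<le> q") auto
      ultimately show ?thesis using True fl by auto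
    qed (use that in auto)
    then have S: "{Suc p..q} = {l \<in> {1..m}. Suc i \<le> f l \<and> f l \<le> j}"
      by (intro set_eqI) (simp only: mem_Collect_eq)
    have "(\<Sum>k=Suc i..j. \<Theta> k) = (\<Sum>k=Suc i..j. \<Sum>l | l \<in> {Suc p..q} \<and> f l = k. \<theta> l)"
      unfolding \<Theta>_def S by (intro sum.cong) auto
    also have "\<dots> = (\<Sum>l=Suc p..q. \<theta> l)"
      using S by (intro sum.group) auto
    finally show ?thesis .
  qed
  have blocks: "(\<Sum>i<F (Suc m). h i) = (\<Sum>p<Suc m. \<Sum>i\<in>{F p..<F (Suc p)}. h i)"
    for h :: "nat \<Rightarrow> complex"
    by (intro sum_lessThan_blocks F_mono F_ends) simp
  have "fdd_log_char \<psi> H n \<Theta> t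
      = (\<Sum>j<F (Suc m). \<Sum>i<F (Suc m). \<psi> (\<Sum>k=Suc i..j. \<Theta> k) * of_real (fdd_weight H n t (Suc i) j))"
    by (simp only: fdd_log_char_eq_full_sum[of \<psi>, OF \<psi>] F_ends)
  also have "\<dots> = (\<Sum>q<Suc m. \<Sum>j\<in>{F q..<F (Suc q)}. \<Sum>p<Suc m. \<Sum>i\<in>{F p..<F (Suc p)}.
      \<psi> (\<Sum>k=Suc i..j. \<Theta> k) * of_real (fdd_weight H n t (Suc i) j))"
    by (simp only: blocks)
  also have "\<dots> = (\<Sum>q<Suc m. \<Sum>p<Suc m. \<Sum>j\<in>{F q..<F (Suc q)}. \<Sum>i\<in>{F p..<F (Suc p)}.
      \<psi> (\<Sum>k=Suc i..j. \<Theta> k) * of_real (fdd_weight H n t (Suc i) j))"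
    by (intro sum.cong refl sum.swap)
  also have "\<dots> = (\<Sum>q<Suc m. \<Sum>p<Suc m. \<Sum>j\<in>{F q..<F (Suc q)}. \<Sum>i\<in>{F p..<F (Suc p)}.
      \<psi> (\<Sum>l=Suc p..q. \<theta> l) * of_real (fdd_weight H n t (Suc i) j))"
  proof (intro sum.cong refl)
    fix q p j i
    assume "q \<in> {..<Suc m}" "p \<in> {..<Suc m}" "j \<in> {F q..<F (Suc q)}" "i \<in> {F p..<F (Suc p)}"
    then show "\<psi> (\<Sum>k=Suc i..j. \<Theta> k) * of_real (fdd_weight H n t (Suc i) j)
        = \<psi> (\<Sum>l=Suc p..q. \<theta> l) * of_real (fdd_weight H n t (Suc i) j)"
      using group[of p q i j] by simp
  qed
  also have "\<dots> = (\<Sum>q<Suc m. \<Sum>p<Suc m. \<psi> (\<Sum>l=Suc p..q. \<theta> l) * of_real (fdd_weight H m s (Suc p) q))"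
    by (intro sum.cong refl) (simp add: weight sum_distrib_left)
  finally show ?thesis
    by (simp only: fdd_log_char_eq_full_sum[of \<psi>, OF \<psi>] \<Theta>_def)
qed

lemma ex_increasing_enumeration:
  fixes J :: "real set"
  assumes "finite J"
  shows "\<exists>u. bij_betw u {1..card J} J \<and> strict_mono_on {1..card J} u"
proof -
  define xs where "xs = sorted_list_of_set J"
  have xs: "distinct xs" "set xs = J" "length xs = card J" "sorted_wrt (<) xs"
    using assms by (simp_all add: xs_def)
  have "bij_betw (\<lambda>k. k - 1) {1..card J} {..<length xs}"
    by (rule bij_betwI[where g=Suc]) (auto simp: xs)
  from bij_betw_trans[OF this bij_betw_nth[OF xs(1) refl refl]]
  show ?thesis
    using sorted_wrt_nth_less[OF xs(4)] xs
    by (intro exI[of _ "\<lambda>k. xs ! (k - 1)"]) (auto simp: strict_mono_on_def o_def)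
qed

text \<open>Every finite family of times, in any order and with repetitions, is read off a strictly increasing
  grid.\<close>
lemma enumerate_times:
  fixes t :: "nat \<Rightarrow> real"
  shows "\<exists>u N g. strict_mono_on {1..N::nat} u \<and>
    g ` {1..n} \<subseteq> {1..N} \<and> (\<forall>k\<in>{1..n}. u (g k) = t k)"
proof -
  obtain u where u: "bij_betw u {1..card (t ` {1..n})} (t ` {1..n})"
      "strict_mono_on {1..card (t ` {1..n})} u"
    using ex_increasing_enumeration[of "t ` {1..n}"] by auto
  show ?thesis
  proof (intro exI conjI ballI)
    show "(\<lambda>k. inv_into {1..card (t ` {1..n})} u (t k)) ` {1..n} \<subseteq> {1..card (t ` {1..n})}"
      using u(1) by (auto simp: bij_betw_def simp del: atLeastAtMost_iff intro!: inv_into_into)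
    show "u (inv_into {1..card (t ` {1..n})} u (t k)) = t k" if "k \<in> {1..n}" for k
      using u(1) that by (intro f_inv_into_f) (auto simp: bij_betw_def)
  qed (use u in auto)
qed

text \<open>Here \<open>f\<close> need not be monotone, for it can permute equal times. Both \<open>s\<close> and \<open>t\<close> are
  monotone readings of the strictly increasing grid of the values of \<open>t\<close>, so both exponents equal
  the one on that grid.\<close>
lemma fdd_log_char_reindex:
  assumes \<psi>: "\<psi> 0 = 0" and s: "ordered_times m s" and t: "ordered_times n t"
    and f: "f ` {1..m} \<subseteq> {1..n}" and st: "\<And>k. k \<in> {1..m} \<Longrightarrow> s k = t (f k)"
  shows "fdd_log_char \<psi> H m \<theta> s = fdd_log_char \<psi> H n (\<lambda>k. \<Sum>l | l \<in> {1..m} \<and> f l = k. \<theta> l) t"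
proof -
  obtain u g and N :: nat where u: "strict_mono_on {1..N} u"
    and g: "g ` {1..n} \<subseteq> {1..N}" "\<And>k. k \<in> {1..n} \<Longrightarrow> u (g k) = t k"
    using enumerate_times[of n t] by metis
  have g_in: "g k \<in> {1..N}" if "k \<in> {1..n}" for k
    using g(1) that by blast
  have g_le: "g k \<le> g l" if "k \<in> {1..n}" "l \<in> {1..n}" "t k \<le> t l" for k l
  proof (rule ccontr)
    assume "\<not> g k \<le> g l"
    then have "u (g l) < u (g k)"
      using that g_in by (intro strict_mono_onD[OF u]) (auto simp: not_le)
    then show False using that g(2) by simp
  qed
  have fk: "f k \<in> {1..n}" if "k \<in> {1..m}" for k using f that by blast
  have "fdd_log_char \<psi> H m \<theta> s = fdd_log_char \<psi> H N (\<lambda>k. \<Sum>l | l \<in> {1..m} \<and> (g \<circ> f) l = k. \<theta> l) u"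
  proof (rule fdd_log_char_refine[where \<psi>=\<psi>, OF \<psi>])
    show "mono_on {1..m} (g \<circ> f)"
      using monotone_onD[OF s] st fk g_le by (auto simp: monotone_on_def simp del: atLeastAtMost_iff)
  qed (use fk g st in auto)
  also have "(\<lambda>k. \<Sum>l | l \<in> {1..m} \<and> (g \<circ> f) l = k. \<theta> l)
      = (\<lambda>k. \<Sum>r | r \<in> {1..n} \<and> g r = k. \<Sum>l | l \<in> {1..m} \<and> f l = r. \<theta> l)"
  proof
    fix k
    have "(\<Sum>l | l \<in> {1..m} \<and> (g \<circ> f) l = k. \<theta> l)
        = (\<Sum>r | r \<in> {1..n} \<and> g r = k. \<Sum>l | l \<in> {l. l \<in> {1..m} \<and> (g \<circ> f) l = k} \<and> f l = r. \<theta> l)"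
      using fk by (intro sum.group[symmetric]) auto
    also have "\<dots> = (\<Sum>r | r \<in> {1..n} \<and> g r = k. \<Sum>l | l \<in> {1..m} \<and> f l = r. \<theta> l)"
      by (intro sum.cong) auto
    finally show "(\<Sum>l | l \<in> {1..m} \<and> (g \<circ> f) l = k. \<theta> l)
        = (\<Sum>r | r \<in> {1..n} \<and> g r = k. \<Sum>l | l \<in> {1..m} \<and> f l = r. \<theta> l)" .
  qed
  also have "fdd_log_char \<psi> H N (\<lambda>k. \<Sum>r | r \<in> {1..n} \<and> g r = k. \<Sum>l | l \<in> {1..m} \<and> f l = r. \<theta> l) u
      = fdd_log_char \<psi> H n (\<lambda>k. \<Sum>l | l \<in> {1..m} \<and> f l = k. \<theta> l) t"
  proof (rule fdd_log_char_refine[where \<psi>=\<psi>, OF \<psi>, symmetric])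
    show "mono_on {1..n} g"
      using monotone_onD[OF t] g_le by (auto simp: monotone_on_def simp del: atLeastAtMost_iff)
  qed (use g in auto)
  finally show ?thesis .
qed

section \<open>The finite-dimensional laws and the process\<close>

text \<open>The powers \<open>c = 1 / m\<close> serve as convolution roots of the law for \<open>c = 1\<close>.\<close>
lemma ex_law_fdd_power:
  assumes id: "infinitely_divisible \<nu>" and "\<psi> = dist_log (char \<nu>)"
    and H: "concave_on {0..} H" "mono H" "\<And>x. H x \<le> 1"
    and t: "ordered_times n t" and c: "0 \<le> c"
  shows "\<exists>\<mu>. prob_law n \<mu> \<and> (\<forall>\<theta>. char_vec n \<mu> \<theta> = exp (of_real c * fdd_log_char \<psi> H n \<theta> t))"
proof (rule ex_law_of_interval_sums[of \<psi> n "\<lambda>i j. c * fdd_weight H n t i j"])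
  show "\<exists>\<rho>. real_distribution \<rho> \<and> (\<forall>\<theta>. char \<rho> \<theta> = exp (of_real b * \<psi> \<theta>))" if "0 \<le> b" for b
    using infinitely_divisible_exp_scaled[OF id that] assms(2) by metis
  show "0 \<le> c * fdd_weight H n t i j" if "1 \<le> i" "i \<le> j" "j \<le> n" for i j
    using c fdd_weight_nonneg[OF H t that] by simp
  fix \<mu> assume "prob_law n \<mu>" and char: "\<And>\<theta>. char_vec n \<mu> \<theta> =
      exp (\<Sum>j=1..n. \<Sum>i=1..j. \<psi> (\<Sum>k=i..j. \<theta> k) * of_real (c * fdd_weight H n t i j))"
  moreover have "char_vec n \<mu> \<theta> = exp (of_real c * fdd_log_char \<psi> H n \<theta> t)" for \<theta>
    unfolding char fdd_log_char_eq_sum_weight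
    by (simp add: sum_distrib_left mult_ac)
  ultimately show ?thesis by blast
qed

lemma char_vec_distr_reindex:
  assumes "prob_law n \<mu>" and f: "f ` {1..m} \<subseteq> {1..n}"
  defines "\<rho> \<equiv> distr \<mu> (Rn m) (\<lambda>x. \<lambda>k\<in>{1..m}. x (f k))"
  shows "prob_law m \<rho>" and "char_vec m \<rho> \<theta> = char_vec n \<mu> (\<lambda>k. \<Sum>l | l \<in> {1..m} \<and> f l = k. \<theta> l)"
proof -
  have P: "prob_space \<mu>" and S[measurable_cong]: "sets \<mu> = sets (Rn n)"
    using assms by (auto simp: prob_law_def)
  have comp: "(\<lambda>x. x (f k)) \<in> borel_measurable \<mu>" if "k \<in> {1..m}" for k
    unfolding measurable_cong_sets[OF S refl]
    using f that by (intro measurable_component_singleton) blast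
  then have meas: "(\<lambda>x. \<lambda>k\<in>{1..m}. x (f k)) \<in> \<mu> \<rightarrow>\<^sub>M Rn m"
    by (rule measurable_restrict)
  show "prob_law m \<rho>"
    unfolding prob_law_def \<rho>_def using prob_space.prob_space_distr[OF P meas] by simp
  have "char_vec m \<rho> \<theta> = (LINT x|\<mu>. iexp (\<Sum>l=1..m. \<theta> l * x (f l)))"
    unfolding char_vec_def \<rho>_def by (subst integral_distr[OF meas]) (auto intro!: borel_measurable_sum)
  moreover have "(\<Sum>l=1..m. \<theta> l * x (f l)) = (\<Sum>k=1..n. (\<Sum>l | l \<in> {1..m} \<and> f l = k. \<theta> l) * x k)" for x :: "nat \<Rightarrow> real"
  proof -
    have "(\<Sum>l=1..m. \<theta> l * x (f l)) = (\<Sum>k=1..n. \<Sum>l | l \<in> {1..m} \<and> f l = k. \<theta> l * x (f l))"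
      using f by (intro sum.group[symmetric]) auto
    also have "\<dots> = (\<Sum>k=1..n. (\<Sum>l | l \<in> {1..m} \<and> f l = k. \<theta> l) * x k)"
      by (simp add: sum_distrib_right)
    finally show ?thesis .
  qed
  ultimately show "char_vec m \<rho> \<theta> = char_vec n \<mu> (\<lambda>k. \<Sum>l | l \<in> {1..m} \<and> f l = k. \<theta> l)"
    by (simp only: char_vec_def)
qed

lemma char_vec_joint_law:
  assumes "real_process M X"
  shows "char_vec n (joint_law M X n t) \<theta> = (LINT \<omega>|M. iexp (\<Sum>k=1..n. \<theta> k * X (t k) \<omega>))"
proof -
  have "(\<lambda>\<omega>. \<lambda>k\<in>{1..n}. X (t k) \<omega>) \<in> M \<rightarrow>\<^sub>M Rn n"
    using assms by (intro measurable_restrict) (auto simp: real_process_def)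
  then show ?thesis
    unfolding char_vec_def joint_law_def
    by (subst integral_distr) (auto intro!: borel_measurable_sum)
qed

lemma joint_law_reindex:
  assumes X: "real_process M X" and g: "g ` {1..n} \<subseteq> {1..N}" and t: "\<And>k. k \<in> {1..n} \<Longrightarrow> u (g k) = t k"
  shows "joint_law M X n t = distr (joint_law M X N u) (Rn n) (\<lambda>x. \<lambda>k\<in>{1..n}. x (g k))"
proof -
  have gk: "g k \<in> {1..N}" if "k \<in> {1..n}" for k using g that by blast
  have "(\<lambda>\<omega>. \<lambda>k\<in>{1..N}. X (u k) \<omega>) \<in> M \<rightarrow>\<^sub>M Rn N"
    using X by (intro measurable_restrict) (auto simp: real_process_def)
  moreover have "(\<lambda>x. \<lambda>k\<in>{1..n}. x (g k)) \<in> Rn N \<rightarrow>\<^sub>M Rn n"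
    by (intro measurable_restrict measurable_component_singleton gk)
  ultimately have "distr (joint_law M X N u) (Rn n) (\<lambda>x. \<lambda>k\<in>{1..n}. x (g k))
      = distr M (Rn n) ((\<lambda>x. \<lambda>k\<in>{1..n}. x (g k)) \<circ> (\<lambda>\<omega>. \<lambda>k\<in>{1..N}. X (u k) \<omega>))"
    unfolding joint_law_def by (intro distr_distr)
  also have "(\<lambda>x. \<lambda>k\<in>{1..n}. x (g k)) \<circ> (\<lambda>\<omega>. \<lambda>k\<in>{1..N}. X (u k) \<omega>) = (\<lambda>\<omega>. \<lambda>k\<in>{1..n}. X (t k) \<omega>)"
    using gk t by (auto simp: fun_eq_iff restrict_def)
  finally show ?thesis unfolding joint_law_def by (rule sym)
qed

text \<open>Ordered times suffice, since the joint law at arbitrary times is an image of the one on the increasing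
  grid of their values.\<close>
lemma stationaryI:
  assumes X: "real_process M X"
    and shift: "\<And>h n t. 1 \<le> n \<Longrightarrow> ordered_times n t \<Longrightarrow>
      joint_law M X n (\<lambda>k. t k + h) = joint_law M X n t"
  shows "stationary M X"
  unfolding stationary_def
proof (intro allI)
  fix h n t
  show "joint_law M X n (\<lambda>k. t k + h) = joint_law M X n t"
  proof (cases "n = 0")
    case True
    then show ?thesis by (simp add: joint_law_def restrict_def)
  next
    case False
    obtain u g and N :: nat where u: "strict_mono_on {1..N} u"
      and g: "g ` {1..n} \<subseteq> {1..N}" "\<And>k. k \<in> {1..n} \<Longrightarrow> u (g k) = t k"
      using enumerate_times[of n t] by metis
    have "g 1 \<in> {1..N}" using False g(1) by (simp add: image_subset_iff)
    then have "1 \<le> N" by simp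
    have "joint_law M X n (\<lambda>k. t k + h)
        = distr (joint_law M X N (\<lambda>k. u k + h)) (Rn n) (\<lambda>x. \<lambda>k\<in>{1..n}. x (g k))"
      using g by (intro joint_law_reindex[OF X]) auto
    also have "joint_law M X N (\<lambda>k. u k + h) = joint_law M X N u"
      using u \<open>1 \<le> N\<close> by (intro shift strict_mono_on_imp_mono_on)
    also have "distr (joint_law M X N u) (Rn n) (\<lambda>x. \<lambda>k\<in>{1..n}. x (g k)) = joint_law M X n t"
      using g by (intro joint_law_reindex[OF X, symmetric]) auto
    finally show ?thesis .
  qed
qed

lemma (in polish_projective) distr_lim_restrict:
  assumes "finite J" "J \<subseteq> I"
  shows "distr lim (PiM J (\<lambda>_. borel)) (\<lambda>x. restrict x J) = P J"
proof (rule measure_eqI)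
  show "sets (distr lim (PiM J (\<lambda>_. borel)) (\<lambda>x. restrict x J)) = sets (P J)"
    using assms by (simp add: sets_P)
  fix A assume A: "A \<in> sets (distr lim (PiM J (\<lambda>_. borel)) (\<lambda>x. restrict x J))"
  have meas: "(\<lambda>x. restrict x J) \<in> lim \<rightarrow>\<^sub>M PiM J (\<lambda>_. borel)"
    using measurable_restrict_subset[OF assms(2), of "\<lambda>_. borel"]
    by (simp cong: measurable_cong_sets)
  have "emeasure (distr lim (PiM J (\<lambda>_. borel)) (\<lambda>x. restrict x J)) A
      = emeasure lim ((\<lambda>x. restrict x J) -` A \<inter> space lim)"
    using A by (intro emeasure_distr meas) simp
  also have "(\<lambda>x. restrict x J) -` A \<inter> space lim = emb I J A"
    by (simp add: prod_emb_def space_PiM)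
  also have "emeasure lim (emb I J A) = emeasure (P J) A"
    using assms A by (intro emeasure_lim_emb) auto
  finally show "emeasure (distr lim (PiM J (\<lambda>_. borel)) (\<lambda>x. restrict x J)) A = emeasure (P J) A" .
qed

text \<open>Only ordered times are constrained; the law for a finite set of times is read off its increasing
  enumeration.\<close>
locale fdd_family =
  fixes \<psi> :: "real \<Rightarrow> complex" and H :: "real \<Rightarrow> real"
    and \<mu> :: "nat \<Rightarrow> (nat \<Rightarrow> real) \<Rightarrow> (nat \<Rightarrow> real) measure"
  assumes \<psi>_0: "\<psi> 0 = 0"
    and law: "\<And>n t. 1 \<le> n \<Longrightarrow> ordered_times n t \<Longrightarrow> prob_law n (\<mu> n t)"
    and char: "\<And>n t \<theta>. 1 \<le> n \<Longrightarrow> ordered_times n t \<Longrightarrow> char_vec n (\<mu> n t) \<theta> = fdd_char \<psi> H n \<theta> t"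
begin

text \<open>More than consistency in the sense of Kolmogorov: \<open>f\<close> need not be injective, which covers
  repeated times.\<close>
lemma reindex:
  assumes "1 \<le> m" "1 \<le> n" "ordered_times m s" "ordered_times n t"
    and f: "f ` {1..m} \<subseteq> {1..n}" and st: "\<And>k. k \<in> {1..m} \<Longrightarrow> s k = t (f k)"
  shows "\<mu> m s = distr (\<mu> n t) (Rn m) (\<lambda>x. \<lambda>k\<in>{1..m}. x (f k))"
proof (rule prob_law_eqI)
  show "char_vec m (\<mu> m s) \<theta> = char_vec m (distr (\<mu> n t) (Rn m) (\<lambda>x. \<lambda>k\<in>{1..m}. x (f k))) \<theta>" for \<theta>
    using assms fdd_log_char_reindex[where \<psi>=\<psi> and H=H and \<theta>=\<theta>, OF \<psi>_0 assms(3,4) f st]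
    by (simp only: char char_vec_distr_reindex(2)[OF law f] fdd_char_def)
qed (use assms law char_vec_distr_reindex(1)[OF law f] in auto)

lemma consistent: "kolmogorov_consistent \<mu>"
  unfolding kolmogorov_consistent_def using reindex by blast

lemma shift:
  assumes "1 \<le> n" "ordered_times n t"
  shows "\<mu> n (\<lambda>k. t k + h) = \<mu> n t"
proof -
  have t': "ordered_times n (\<lambda>k. t k + h)"
    using assms(2) by (simp add: monotone_on_def)
  show ?thesis
    by (rule prob_law_eqI[where n=n])
       (use assms t' in \<open>simp_all add: law char fdd_char_def fdd_log_char_shift\<close>)
qed

text \<open>Kolmogorov's extension theorem is applied to the laws \<open>P J\<close> on \<open>\<real>\<^sup>J\<close> for finite sets \<open>J\<close> of times.
  They are read off a law \<open>\<mu> (card K) (u K)\<close> with \<open>K \<supseteq> J\<close> through the rank \<open>r K\<close> of a time in \<open>K\<close>.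
  By \<open>reindex\<close> the choice of \<open>K\<close> is immaterial, which makes the family projective.\<close>
lemma ex_process:
  obtains M :: "(real \<Rightarrow> real) measure" and X
  where "real_process M X" "\<And>n t. 1 \<le> n \<Longrightarrow> ordered_times n t \<Longrightarrow> joint_law M X n t = \<mu> n t"
proof -
  define u where "u J = (SOME u. bij_betw u {1..card J} (J :: real set) \<and> strict_mono_on {1..card J} u)" for J
  have u: "bij_betw (u J) {1..card J} J" "strict_mono_on {1..card J} (u J)" if "finite J" for J
    using someI_ex[OF ex_increasing_enumeration[OF that]] by (auto simp: u_def)
  define r where "r J = inv_into {1..card J} (u J)" for J
  have r: "r J s \<in> {1..card J}" "u J (r J s) = s" if "finite J" "s \<in> J" for J s
    using u(1)[OF that(1)] that(2) unfolding r_def bij_betw_def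
    by (auto simp del: atLeastAtMost_iff intro: inv_into_into f_inv_into_f)
  have ord: "ordered_times (card J) (u J)" if "finite J" for J
    using u(2)[OF that] by (rule strict_mono_on_imp_mono_on)
  define Q where "Q K J = distr (\<mu> (card K) (u K)) (PiM J (\<lambda>_. borel)) (\<lambda>x. \<lambda>s\<in>J. x (r K s))" for K J
  \<comment> \<open>The empty \<open>J\<close> must be allowed, but \<open>\<mu>\<close> is constrained only for at least one time; hence the time 0 is adjoined.\<close>
  define P where "P J = Q (insert 0 J) J" for J
  have sets_\<mu>: "sets (\<mu> (card K) (u K)) = sets (Rn (card K))" "1 \<le> card K" if "finite K" "K \<noteq> {}" for K
    using law[OF _ ord[OF that(1)]] that by (auto simp: prob_law_def Suc_le_eq card_gt_0_iff)
  have meas: "(\<lambda>x. \<lambda>s\<in>J. x (r K s)) \<in> \<mu> (card K) (u K) \<rightarrow>\<^sub>M PiM J (\<lambda>_. borel)"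
    if "finite K" "J \<subseteq> K" "K \<noteq> {}" for J K
  proof -
    have "(\<lambda>x. \<lambda>s\<in>J. x (r K s)) \<in> Rn (card K) \<rightarrow>\<^sub>M PiM J (\<lambda>_. borel)"
      using that by (intro measurable_restrict measurable_component_singleton r) auto
    then show ?thesis
      using sets_\<mu>(1)[OF that(1,3)] by (simp cong: measurable_cong_sets)
  qed
  have Q_mono: "Q L J = Q K J" if K: "finite K" "L \<subseteq> K" "J \<subseteq> L" "L \<noteq> {}" for J K L
  proof -
    have L: "finite L" using K finite_subset by blast
    have uL: "u L k \<in> L" if "k \<in> {1..card L}" for k
      using u(1)[OF L] that by (auto simp: bij_betw_def)
    have "K \<noteq> {}" using K by auto
    have f: "(\<lambda>k. r K (u L k)) ` {1..card L} \<subseteq> {1..card K}"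
      using r(1)[OF K(1)] uL K(2) by blast
    have "\<mu> (card L) (u L) = distr (\<mu> (card K) (u K)) (Rn (card L)) (\<lambda>x. \<lambda>k\<in>{1..card L}. x (r K (u L k)))"
    proof (intro reindex ord f)
      show "u L k = u K (r K (u L k))" if "k \<in> {1..card L}" for k
        using r(2)[OF K(1), of "u L k"] uL[OF that] K(2) by auto
    qed (use K L \<open>K \<noteq> {}\<close> sets_\<mu>(2) in auto)
    moreover have "(\<lambda>x. \<lambda>k\<in>{1..card L}. x (r K (u L k))) \<in> \<mu> (card K) (u K) \<rightarrow>\<^sub>M Rn (card L)"
    proof -
      have "(\<lambda>x. \<lambda>k\<in>{1..card L}. x (r K (u L k))) \<in> Rn (card K) \<rightarrow>\<^sub>M Rn (card L)"
        using f by (intro measurable_restrict measurable_component_singleton) blast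
      then show ?thesis
        using sets_\<mu>(1)[OF K(1) \<open>K \<noteq> {}\<close>] by (simp cong: measurable_cong_sets)
    qed
    moreover have "(\<lambda>x. \<lambda>s\<in>J. x (r L s)) \<in> Rn (card L) \<rightarrow>\<^sub>M PiM J (\<lambda>_. borel)"
      using K L by (intro measurable_restrict measurable_component_singleton r) auto
    ultimately have "Q L J = distr (\<mu> (card K) (u K)) (PiM J (\<lambda>_. borel))
        ((\<lambda>x. \<lambda>s\<in>J. x (r L s)) \<circ> (\<lambda>x. \<lambda>k\<in>{1..card L}. x (r K (u L k))))"
      unfolding Q_def by (simp only: distr_distr)
    also have "(\<lambda>x. \<lambda>s\<in>J. x (r L s)) \<circ> (\<lambda>x. \<lambda>k\<in>{1..card L}. x (r K (u L k)))
        = (\<lambda>x :: nat \<Rightarrow> real. \<lambda>s\<in>J. x (r K s))"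
    proof (intro ext)
      fix x :: "nat \<Rightarrow> real" and s
      show "((\<lambda>x. \<lambda>s\<in>J. x (r L s)) \<circ> (\<lambda>x. \<lambda>k\<in>{1..card L}. x (r K (u L k)))) x s = (\<lambda>s\<in>J. x (r K s)) s"
        using r[OF L, of s] K(3) by (cases "s \<in> J") (auto simp del: atLeastAtMost_iff)
    qed
    finally show ?thesis by (simp only: Q_def)
  qed
  interpret polish_projective UNIV P
  proof (intro polish_projective.intro projective_family.intro)
    fix J K :: "real set" assume JK: "J \<subseteq> K" "finite K"
    have 1: "(\<lambda>x. restrict x J) \<in> PiM K (\<lambda>_. borel) \<rightarrow>\<^sub>M PiM J (\<lambda>_. borel)"
      using JK by (rule_tac measurable_restrict_subset)
    have 2: "(\<lambda>x. \<lambda>s\<in>K. x (r (insert 0 K) s)) \<in> \<mu> (card (insert 0 K)) (u (insert 0 K)) \<rightarrow>\<^sub>M PiM K (\<lambda>_. borel)"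
      using JK by (intro meas) auto
    have "distr (P K) (PiM J (\<lambda>_. borel)) (\<lambda>x. restrict x J) =
       distr (\<mu> (card (insert 0 K)) (u (insert 0 K))) (PiM J (\<lambda>_. borel))
         ((\<lambda>x. restrict x J) \<circ> (\<lambda>x. \<lambda>s\<in>K. x (r (insert 0 K) s)))"
      unfolding P_def Q_def by (rule distr_distr[OF 1 2])
    also have "(\<lambda>x. restrict x J) \<circ> (\<lambda>x. \<lambda>s\<in>K. x (r (insert 0 K) s)) = (\<lambda>x. \<lambda>s\<in>J. x (r (insert 0 K) s))"
      using JK by (auto simp: fun_eq_iff restrict_def)
    also have "distr (\<mu> (card (insert 0 K)) (u (insert 0 K))) (PiM J (\<lambda>_. borel)) \<dots> = Q (insert 0 K) J"
      by (simp add: Q_def)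
    also have "\<dots> = P J"
      unfolding P_def using JK by (intro Q_mono[symmetric]) auto
    finally show "P J = distr (P K) (PiM J (\<lambda>_. borel)) (\<lambda>x. restrict x J)" by (rule sym)
  next
    fix J :: "real set" assume J: "finite J"
    have "prob_space (\<mu> (card (insert 0 J)) (u (insert 0 J)))"
      using law[OF _ ord[of "insert 0 J"]] J sets_\<mu>(2)[of "insert 0 J"] by (auto simp: prob_law_def)
    then show "prob_space (P J)"
      unfolding P_def Q_def using J by (intro prob_space.prob_space_distr meas) auto
  qed
  define X :: "real \<Rightarrow> (real \<Rightarrow> real) \<Rightarrow> real" where "X s \<omega> = \<omega> s" for s \<omega>
  have X: "real_process lim X"
    unfolding real_process_def X_def
  proof (intro conjI allI)
    fix s :: real
    show "(\<lambda>\<omega>. \<omega> s) \<in> borel_measurable lim"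
      using measurable_component_singleton[of s UNIV "\<lambda>_. borel"] by (simp cong: measurable_cong_sets)
  qed (rule P.prob_space_axioms)
  moreover have "joint_law lim X n t = \<mu> n t" if n: "1 \<le> n" "ordered_times n t" for n t
  proof -
    define J where "J = t ` {1..n}"
    have J: "finite J" "J \<noteq> {}" using n by (auto simp: J_def)
    have tJ: "t k \<in> J" if "k \<in> {1..n}" for k using that by (simp add: J_def)
    have 1: "(\<lambda>y. \<lambda>k\<in>{1..n}. y (t k)) \<in> PiM J (\<lambda>_. borel) \<rightarrow>\<^sub>M Rn n"
      by (intro measurable_restrict measurable_component_singleton tJ)
    have 2: "(\<lambda>x. restrict x J) \<in> lim \<rightarrow>\<^sub>M PiM J (\<lambda>_. borel)"
      using measurable_restrict_subset[of J UNIV "\<lambda>_. borel"] by (simp cong: measurable_cong_sets)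
    have "joint_law lim X n t
        = distr lim (Rn n) ((\<lambda>y. \<lambda>k\<in>{1..n}. y (t k)) \<circ> (\<lambda>x. restrict x J))"
      unfolding joint_law_def X_def using tJ
      by (intro arg_cong[where f="distr lim (Rn n)"]) (auto simp: fun_eq_iff restrict_def)
    also have "\<dots> = distr (P J) (Rn n) (\<lambda>y. \<lambda>k\<in>{1..n}. y (t k))"
      using distr_distr[OF 1 2] J by (simp add: distr_lim_restrict)
    also have "P J = Q J J"
      unfolding P_def using J by (intro Q_mono[symmetric]) auto
    also have "distr (Q J J) (Rn n) (\<lambda>y. \<lambda>k\<in>{1..n}. y (t k))
        = distr (\<mu> (card J) (u J)) (Rn n) ((\<lambda>y. \<lambda>k\<in>{1..n}. y (t k)) \<circ> (\<lambda>x. \<lambda>s\<in>J. x (r J s)))"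
      unfolding Q_def using J by (intro distr_distr[OF 1] meas) auto
    also have "(\<lambda>y. \<lambda>k\<in>{1..n}. y (t k)) \<circ> (\<lambda>x. \<lambda>s\<in>J. x (r J s)) = (\<lambda>x. \<lambda>k\<in>{1..n}. x (r J (t k)))"
      using tJ by (auto simp: fun_eq_iff restrict_def)
    also have "distr (\<mu> (card J) (u J)) (Rn n) \<dots> = \<mu> n t"
      using J n tJ r[OF J(1)] by (intro reindex[symmetric] ord sets_\<mu>) auto
    finally show ?thesis .
  qed
  ultimately show ?thesis by (rule that)
qed

end

section \<open>Covariances\<close>

text \<open>The difference quotients of \<open>iexp (\<theta> * Y)\<close> are dominated by \<open>\<bar>Y\<bar>\<close>. The weight \<open>W\<close> allows the
  lemma to be applied again to the derivative.\<close>
lemma (in prob_space) has_vector_derivative_integral_iexp: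
  fixes Y :: "'a \<Rightarrow> real" and W :: "'a \<Rightarrow> complex"
  assumes [measurable]: "Y \<in> borel_measurable M" and W: "integrable M W"
    and YW: "integrable M (\<lambda>x. of_real (Y x) * W x)"
  shows "((\<lambda>\<theta>. LINT x|M. W x * iexp (\<theta> * Y x)) has_vector_derivative
      (LINT x|M. \<i> * (of_real (Y x) * W x) * iexp (\<theta> * Y x))) (at \<theta>)"
proof -
  have [measurable]: "W \<in> borel_measurable M" using W by auto
  define f where "f \<theta> = (LINT x|M. W x * iexp (\<theta> * Y x))" for \<theta>
  define D where "D = (LINT x|M. \<i> * (of_real (Y x) * W x) * iexp (\<theta> * Y x))"
  have int: "integrable M (\<lambda>x. W x * iexp (a * Y x))" for a
    by (rule Bochner_Integration.integrable_bound[OF W]) (auto simp: norm_mult)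
  have quotient: "((\<lambda>h. (f (\<theta> + h) - f \<theta>) / of_real h) \<longlongrightarrow> D) (at 0)"
    unfolding tendsto_at_iff_sequentially comp_def
  proof safe
    fix s :: "nat \<Rightarrow> real" assume ne: "\<forall>i. s i \<in> UNIV - {0}" and s: "s \<longlonglongrightarrow> 0"
    have "(f (\<theta> + s n) - f \<theta>) / of_real (s n)
        = (LINT x|M. (W x * iexp ((\<theta> + s n) * Y x) - W x * iexp (\<theta> * Y x)) / of_real (s n))" for n
      unfolding f_def using Bochner_Integration.integral_diff[OF int[of "\<theta> + s n"] int[of \<theta>]] by simp
    moreover have "(\<lambda>n. LINT x|M. (W x * iexp ((\<theta> + s n) * Y x) - W x * iexp (\<theta> * Y x)) / of_real (s n)) \<longlonglongrightarrow> D"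
      unfolding D_def
    proof (rule integral_dominated_convergence[where w="\<lambda>x. norm (of_real (Y x) * W x)"])
      show "integrable M (\<lambda>x. norm (of_real (Y x) * W x))" using YW by simp
      show "AE x in M. (\<lambda>n. (W x * iexp ((\<theta> + s n) * Y x) - W x * iexp (\<theta> * Y x)) / of_real (s n))
          \<longlonglongrightarrow> \<i> * (of_real (Y x) * W x) * iexp (\<theta> * Y x)"
      proof (rule AE_I2)
        fix x
        have "((\<lambda>z. W x * exp (\<i> * ((of_real \<theta> + z) * of_real (Y x)))) has_field_derivative
            \<i> * (of_real (Y x) * W x) * iexp (\<theta> * Y x)) (at 0)"
          by (auto intro!: derivative_eq_intros)
        then have "((\<lambda>z. (W x * exp (\<i> * ((of_real \<theta> + z) * of_real (Y x))) - W x * iexp (\<theta> * Y x)) / z)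
            \<longlongrightarrow> \<i> * (of_real (Y x) * W x) * iexp (\<theta> * Y x)) (at 0)"
          by (simp add: has_field_derivative_iff)
        moreover have "(\<lambda>n. complex_of_real (s n)) \<longlonglongrightarrow> 0"
          using tendsto_of_real[OF s] by simp
        ultimately show "(\<lambda>n. (W x * iexp ((\<theta> + s n) * Y x) - W x * iexp (\<theta> * Y x)) / of_real (s n))
          \<longlonglongrightarrow> \<i> * (of_real (Y x) * W x) * iexp (\<theta> * Y x)"
          using ne unfolding tendsto_at_iff_sequentially comp_def by simp
      qed
      show "AE x in M. norm ((W x * iexp ((\<theta> + s n) * Y x) - W x * iexp (\<theta> * Y x)) / of_real (s n))
          \<le> norm (of_real (Y x) * W x)" for n
      proof (rule AE_I2)
        fix x
        have "norm (iexp (s n * Y x) - 1) \<le> \<bar>s n * Y x\<bar>"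
          using iexp_approx1[of "s n * Y x" 0] by simp
        moreover have "W x * iexp ((\<theta> + s n) * Y x) - W x * iexp (\<theta> * Y x)
            = W x * iexp (\<theta> * Y x) * (iexp (s n * Y x) - 1)"
          by (simp add: exp_add algebra_simps)
        ultimately have "norm (W x * iexp ((\<theta> + s n) * Y x) - W x * iexp (\<theta> * Y x)) \<le> norm (W x) * \<bar>s n * Y x\<bar>"
          by (simp add: norm_mult mult_left_mono)
        then show "norm ((W x * iexp ((\<theta> + s n) * Y x) - W x * iexp (\<theta> * Y x)) / of_real (s n))
          \<le> norm (of_real (Y x) * W x)"
          using ne by (simp add: norm_divide norm_mult abs_mult divide_le_eq mult_ac)
      qed
    qed measurable
    ultimately show "(\<lambda>n. (f (\<theta> + s n) - f \<theta>) / of_real (s n)) \<longlonglongrightarrow> D"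
      by (simp only:)
  qed
  have "((\<lambda>h. (Re (f (\<theta> + h)) - Re (f \<theta>)) / h) \<longlongrightarrow> Re D) (at 0)"
    "((\<lambda>h. (Im (f (\<theta> + h)) - Im (f \<theta>)) / h) \<longlongrightarrow> Im D) (at 0)"
    using tendsto_Re[OF quotient] tendsto_Im[OF quotient] by simp_all
  then have "(f has_vector_derivative D) (at \<theta>)"
    by (simp add: has_vector_derivative_complex_iff DERIV_def)
  then show ?thesis by (simp add: f_def[abs_def] D_def)
qed

text \<open>Near \<open>\<theta>\<close> the increment of \<open>\<eta>\<close> is so small that it is the principal logarithm of
  \<open>\<gamma> x / \<gamma> \<theta>\<close>.\<close>
lemma has_vector_derivative_continuous_log:
  fixes \<eta> \<gamma> :: "real \<Rightarrow> complex"
  assumes \<eta>: "isCont \<eta> \<theta>" and exp: "\<And>x. exp (\<eta> x) = \<gamma> x" and D: "(\<gamma> has_vector_derivative D) (at \<theta>)"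
  shows "(\<eta> has_vector_derivative D / \<gamma> \<theta>) (at \<theta>)"
proof -
  have nz: "\<gamma> \<theta> \<noteq> 0" using exp[of \<theta>] by (metis exp_not_eq_zero)
  obtain d where d: "d > 0" "\<And>x. dist x \<theta> < d \<Longrightarrow> dist (\<eta> x) (\<eta> \<theta>) < pi"
    using \<eta> pi_gt_zero unfolding continuous_at_eps_delta by metis
  have "((\<lambda>x. \<gamma> x / \<gamma> \<theta>) has_vector_derivative D / \<gamma> \<theta>) (at \<theta>)"
    using D by (rule has_vector_derivative_divide)
  moreover have "(Ln has_field_derivative 1) (at (\<gamma> \<theta> / \<gamma> \<theta>))"
    using nz by (auto intro!: derivative_eq_intros)
  ultimately have "((Ln \<circ> (\<lambda>x. \<gamma> x / \<gamma> \<theta>)) has_vector_derivative D / \<gamma> \<theta> * 1) (at \<theta>)"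
    by (rule field_vector_diff_chain_at)
  then have "((\<lambda>x. Ln (\<gamma> x / \<gamma> \<theta>) + \<eta> \<theta>) has_vector_derivative D / \<gamma> \<theta>) (at \<theta>)"
    by (auto intro!: derivative_eq_intros simp: o_def)
  then show ?thesis
  proof (rule has_vector_derivative_transform_within[OF _ d(1)])
    fix x assume "dist x \<theta> < d"
    then have "\<bar>Im (\<eta> x - \<eta> \<theta>)\<bar> < pi"
      using d(2)[of x] abs_Im_le_cmod[of "\<eta> x - \<eta> \<theta>"] by (simp add: dist_norm)
    then have "Ln (exp (\<eta> x - \<eta> \<theta>)) = \<eta> x - \<eta> \<theta>"
      by (intro Ln_exp) auto
    then show "Ln (\<gamma> x / \<gamma> \<theta>) + \<eta> \<theta> = \<eta> x"
      by (simp add: exp_diff exp)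
  qed simp
qed

text \<open>With \<open>\<eta> = log \<phi>\<close> this is \<open>\<eta>' = \<phi>' / \<phi>\<close> and \<open>\<eta>'' 0 = \<phi>'' 0 - (\<phi>' 0)\<^sup>2\<close>, minus the variance
  of \<open>Y\<close>.\<close>
lemma (in prob_space) log_char_derivatives:
  fixes Y :: "'a \<Rightarrow> real"
  assumes [measurable]: "Y \<in> borel_measurable M" and Y2: "integrable M (\<lambda>x. (Y x)\<^sup>2)"
    and \<eta>: "continuous_on UNIV \<eta>" "\<And>\<theta>. exp (\<eta> \<theta>) = (LINT x|M. iexp (\<theta> * Y x))"
  obtains \<eta>' where "\<And>\<theta>. (\<eta> has_vector_derivative \<eta>' \<theta>) (at \<theta>)"
    "(\<eta>' has_vector_derivative of_real ((expectation Y)\<^sup>2 - expectation (\<lambda>x. (Y x)\<^sup>2))) (at 0)"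
proof -
  have Y: "integrable M Y"
    using square_integrable_imp_integrable[OF _ Y2] by simp
  define \<phi>0 where "\<phi>0 \<theta> = (LINT x|M. iexp (\<theta> * Y x))" for \<theta>
  define \<phi>1 where "\<phi>1 \<theta> = (LINT x|M. \<i> * of_real (Y x) * iexp (\<theta> * Y x))" for \<theta>
  define \<phi>2 where "\<phi>2 = (LINT x|M. - of_real ((Y x)\<^sup>2) * iexp (0 * Y x))"
  have d0: "(\<phi>0 has_vector_derivative \<phi>1 \<theta>) (at \<theta>)" for \<theta>
    using has_vector_derivative_integral_iexp[of Y "\<lambda>_. 1" \<theta>] Y
    by (simp add: \<phi>0_def[abs_def] \<phi>1_def)
  have "integrable M (\<lambda>x. \<i> * complex_of_real ((Y x)\<^sup>2))"
    using Y2 by (intro integrable_mult_right integrable_of_real)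
  moreover have "\<i> * complex_of_real ((Y x)\<^sup>2) = complex_of_real (Y x) * (\<i> * of_real (Y x))" for x
    by (simp add: power2_eq_square mult_ac)
  ultimately have "integrable M (\<lambda>x. complex_of_real (Y x) * (\<i> * of_real (Y x)))"
    by (simp only:)
  then have d1: "(\<phi>1 has_vector_derivative \<phi>2) (at 0)"
    using has_vector_derivative_integral_iexp[of Y "\<lambda>x. \<i> * of_real (Y x)" 0] Y
    by (simp add: \<phi>1_def[abs_def] \<phi>2_def power2_eq_square mult_ac)
  have v: "\<phi>0 0 = 1" "\<phi>1 0 = \<i> * of_real (expectation Y)" "\<phi>2 = - of_real (expectation (\<lambda>x. (Y x)\<^sup>2))"
    using prob_space by (simp_all add: \<phi>0_def \<phi>1_def \<phi>2_def del: of_real_power)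
  show ?thesis
  proof
    show "(\<eta> has_vector_derivative \<phi>1 \<theta> / \<phi>0 \<theta>) (at \<theta>)" for \<theta>
    proof (rule has_vector_derivative_continuous_log[OF _ _ d0])
      show "isCont \<eta> \<theta>" using \<eta>(1) by (simp add: continuous_on_eq_continuous_at)
      show "exp (\<eta> x) = \<phi>0 x" for x by (simp only: \<eta>(2) \<phi>0_def)
    qed
    have "(inverse has_field_derivative - 1) (at (\<phi>0 0))"
      using DERIV_inverse[of "\<phi>0 0"] by (simp add: v)
    then have "((inverse \<circ> \<phi>0) has_vector_derivative \<phi>1 0 * - 1) (at 0)"
      by (rule field_vector_diff_chain_at[OF d0])
    then have "((\<lambda>\<theta>. \<phi>1 \<theta> * (inverse \<circ> \<phi>0) \<theta>) has_vector_derivative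
        \<phi>1 0 * (\<phi>1 0 * - 1) + \<phi>2 * (inverse \<circ> \<phi>0) 0) (at 0)"
      by (rule has_vector_derivative_mult[OF d1])
    moreover have "\<phi>1 0 * (\<phi>1 0 * - 1) + \<phi>2 * (inverse \<circ> \<phi>0) 0
        = of_real ((expectation Y)\<^sup>2 - expectation (\<lambda>x. (Y x)\<^sup>2))"
      by (simp add: v power2_eq_square algebra_simps)
    ultimately show "((\<lambda>\<theta>. \<phi>1 \<theta> / \<phi>0 \<theta>) has_vector_derivative
        of_real ((expectation Y)\<^sup>2 - expectation (\<lambda>x. (Y x)\<^sup>2))) (at 0)"
      by (simp only: o_def divide_inverse)
  qed
qed

lemma fdd_log_char_1:
  assumes "H 0 = 0"
  shows "fdd_log_char \<psi> H 1 \<theta> t = \<psi> (\<theta> 1)"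
  unfolding fdd_log_char_eq_sum_weight fdd_weight_def Let_def
  using assms by (simp add: ext_df_def ext_time_def)

lemma fdd_log_char_2:
  assumes "H 0 = 0"
  shows "fdd_log_char \<psi> H 2 \<theta> t = of_real (H (t 2 - t 1)) * (\<psi> (\<theta> 1) + \<psi> (\<theta> 2))
    + of_real (1 - H (t 2 - t 1)) * \<psi> (\<theta> 1 + \<theta> 2)"
proof -
  have [simp]: "{Suc 0..2} = {1, 2}" "{2..2::nat} = {2}" by auto
  show ?thesis
    unfolding fdd_log_char_eq_sum_weight fdd_weight_def Let_def
    using assms by (simp add: ext_df_def ext_time_def algebra_simps numeral_2_eq_2[symmetric])
qed

lemma fdd_char_marginal:
  assumes X: "real_process M X" "has_fdd_char M X (fdd_char \<psi> H)" and "H 0 = 0"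
  shows "(LINT \<omega>|M. iexp (\<theta> * X t \<omega>)) = exp (\<psi> \<theta>)"
proof -
  have "(LINT \<omega>|M. iexp (\<Sum>k=1..1::nat. \<theta> * X t \<omega>)) = fdd_char \<psi> H 1 (\<lambda>_. \<theta>) (\<lambda>_. t)"
    using X(2)[unfolded has_fdd_char_def, rule_format, of 1 "\<lambda>_. t" "\<lambda>_. \<theta>"]
    by (simp add: monotone_on_def)
  then show ?thesis by (simp add: fdd_char_def fdd_log_char_1[where H=H, OF assms(3), unfolded One_nat_def])
qed

text \<open>With coefficients \<open>\<theta>\<close> and \<open>- \<theta>\<close> the pairs alive at both times cancel; those alive at only one of
  them have mass \<open>H h\<close> each.\<close>
lemma fdd_char_difference:
  assumes X: "real_process M X" "has_fdd_char M X (fdd_char \<psi> H)" and "H 0 = 0" "\<psi> 0 = 0" "0 \<le> h"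
  shows "(LINT \<omega>|M. iexp (\<theta> * (X t \<omega> - X (t + h) \<omega>))) = exp (of_real (H h) * (\<psi> \<theta> + \<psi> (- \<theta>)))"
proof -
  define s where "s k = (if k = 1 then t else t + h)" for k :: nat
  define \<alpha> where "\<alpha> k = (if k = 1 then \<theta> else - \<theta>)" for k :: nat
  have "ordered_times 2 s" using \<open>0 \<le> h\<close> by (auto simp: monotone_on_def s_def)
  then have "(LINT \<omega>|M. iexp (\<Sum>k=1..2. \<alpha> k * X (s k) \<omega>)) = fdd_char \<psi> H 2 \<alpha> s"
    using X(2) unfolding has_fdd_char_def by auto
  moreover have "(\<Sum>k=1..2. \<alpha> k * X (s k) \<omega>) = \<theta> * (X t \<omega> - X (t + h) \<omega>)" for \<omega>
  proof -
    have "{1..2::nat} = {1, 2}" by auto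
    then show ?thesis by (simp add: \<alpha>_def s_def algebra_simps)
  qed
  ultimately have "(LINT \<omega>|M. iexp (\<theta> * (X t \<omega> - X (t + h) \<omega>))) = fdd_char \<psi> H 2 \<alpha> s"
    by (simp only:)
  also have "\<dots> = exp (of_real (H h) * (\<psi> \<theta> + \<psi> (- \<theta>)))"
    using assms by (simp add: fdd_char_def fdd_log_char_2 \<alpha>_def s_def)
  finally show ?thesis .
qed

lemma distr_eqI_char:
  assumes "prob_space M" "prob_space N" "X \<in> borel_measurable M" "Y \<in> borel_measurable N"
    and "\<And>\<theta>. (LINT x|M. iexp (\<theta> * X x)) = (LINT x|N. iexp (\<theta> * Y x))"
  shows "distr M borel X = distr N borel Y"
proof (rule Levy_uniqueness)
  show "char (distr M borel X) = char (distr N borel Y)"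
    unfolding char_def using assms by (auto simp: integral_distr)
qed (use assms prob_space.real_distribution_distr in auto)

text \<open>The second moment of \<open>X s - X (s + h)\<close> is read off the second derivative of its exponent, and polarisation
  gives \<open>E (X s * X (s + h))\<close> for \<open>h \<ge> 0\<close>. Negative \<open>h\<close> reduces to this by symmetry.\<close>
lemma covariance_fdd:
  fixes M :: "'w measure"
  assumes P: "prob_space P" and X0: "X0 \<in> borel_measurable P" "integrable P (\<lambda>x. (X0 x)\<^sup>2)"
    and \<psi>: "continuous_on UNIV \<psi>" "\<psi> 0 = 0" "\<And>\<theta>. exp (\<psi> \<theta>) = (LINT x|P. iexp (\<theta> * X0 x))"
    and H: "H 0 = 0"
    and X: "real_process M X" "has_fdd_char M X (fdd_char \<psi> H)"
  shows "integrable M (\<lambda>\<omega>. (X t \<omega>)\<^sup>2)"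
    and "complex_of_real (covariance M (X t) (X (t + h))) =
      - vector_derivative (\<lambda>\<theta>. vector_derivative \<psi> (at \<theta>)) (at 0) * complex_of_real (1 - H \<bar>h\<bar>)"
proof -
  interpret P: prob_space P by fact
  interpret M: prob_space M using X by (simp add: real_process_def)
  have [measurable]: "X s \<in> borel_measurable M" for s using X by (simp add: real_process_def)
  note X0(1)[measurable]
  define m where "m = (LINT x|P. X0 x)"
  define q where "q = (LINT x|P. (X0 x)\<^sup>2)"
  have law: "distr M borel (X s) = distr P borel X0" for s
    using P X0(1) fdd_char_marginal[OF X H, of _ s] \<psi>(3)
    by (intro distr_eqI_char) (auto simp: M.prob_space_axioms)
  have sq: "integrable M (\<lambda>\<omega>. (X s \<omega>)\<^sup>2)" for s
    using integrable_distr_eq[of "X s" M borel "\<lambda>x. x\<^sup>2"] integrable_distr_eq[of X0 P borel "\<lambda>x. x\<^sup>2"] X0(2)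
    by (simp add: law)
  then show "integrable M (\<lambda>\<omega>. (X t \<omega>)\<^sup>2)" .
  have int: "integrable M (X s)" for s
    using M.square_integrable_imp_integrable[OF _ sq] by simp
  have transfer: "(LINT \<omega>|M. f (X s \<omega>)) = (LINT x|P. f (X0 x))"
    if "f \<in> borel_measurable borel" for f :: "real \<Rightarrow> real" and s
  proof -
    have "(LINT \<omega>|M. f (X s \<omega>)) = (LINT y|distr M borel (X s). f y)"
      using that by (simp add: integral_distr)
    also have "\<dots> = (LINT x|P. f (X0 x))"
      unfolding law using that by (simp add: integral_distr)
    finally show ?thesis .
  qed
  have moments: "(LINT \<omega>|M. X s \<omega>) = m" "(LINT \<omega>|M. (X s \<omega>)\<^sup>2) = q" for s
    unfolding m_def q_def by (rule transfer, measurable)+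
  obtain \<psi>' where \<psi>': "\<And>\<theta>. (\<psi> has_vector_derivative \<psi>' \<theta>) (at \<theta>)"
    "(\<psi>' has_vector_derivative of_real (m\<^sup>2 - q)) (at 0)"
    using P.log_char_derivatives[OF X0 \<psi>(1,3)] unfolding m_def q_def by metis
  have "(\<lambda>\<theta>. vector_derivative \<psi> (at \<theta>)) = \<psi>'"
    using \<psi>'(1) by (auto intro: vector_derivative_at)
  then have \<psi>'': "vector_derivative (\<lambda>\<theta>. vector_derivative \<psi> (at \<theta>)) (at 0) = of_real (m\<^sup>2 - q)"
    using \<psi>'(2) by (simp only: vector_derivative_at)
  have prod: "integrable M (\<lambda>\<omega>. X s \<omega> * X r \<omega>)" for s r
  proof (rule Bochner_Integration.integrable_bound)
    show "integrable M (\<lambda>\<omega>. (X s \<omega>)\<^sup>2 + (X r \<omega>)\<^sup>2)" using sq by simp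
    have "\<bar>a * b\<bar> \<le> a\<^sup>2 + b\<^sup>2" for a b :: real
      using sum_squares_bound[of "\<bar>a\<bar>" "\<bar>b\<bar>"] mult_nonneg_nonneg[of "\<bar>a\<bar>" "\<bar>b\<bar>"]
      unfolding abs_mult power2_abs by linarith
    then show "AE \<omega> in M. norm (X s \<omega> * X r \<omega>) \<le> norm ((X s \<omega>)\<^sup>2 + (X r \<omega>)\<^sup>2)"
      by (intro AE_I2) simp
  qed measurable
  have pos: "(LINT \<omega>|M. X s \<omega> * X (s + h) \<omega>) = m\<^sup>2 + (q - m\<^sup>2) * (1 - H h)" if "0 \<le> h" for s h
  proof -
    define Z where "Z \<omega> = X s \<omega> - X (s + h) \<omega>" for \<omega>
    have [measurable]: "Z \<in> borel_measurable M" unfolding Z_def by measurable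
    have expand: "(Z \<omega>)\<^sup>2 = (X s \<omega>)\<^sup>2 + (X (s + h) \<omega>)\<^sup>2 - 2 * (X s \<omega> * X (s + h) \<omega>)" for \<omega>
      by (simp add: Z_def power2_eq_square algebra_simps)
    have Z2: "integrable M (\<lambda>\<omega>. (Z \<omega>)\<^sup>2)"
      unfolding expand using sq prod by simp
    have EZ: "M.expectation Z = 0"
      unfolding Z_def using int by (simp add: moments)
    define \<eta> where "\<eta> \<theta> = of_real (H h) * (\<psi> \<theta> + \<psi> (- \<theta>))" for \<theta>
    have "continuous_on UNIV \<eta>"
      unfolding \<eta>_def
      by (intro continuous_intros \<psi>(1) continuous_on_compose2[OF \<psi>(1), of UNIV uminus]) auto
    moreover have "exp (\<eta> \<theta>) = (LINT \<omega>|M. iexp (\<theta> * Z \<omega>))" for \<theta>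
      unfolding Z_def \<eta>_def by (rule fdd_char_difference[OF X H \<psi>(2) that, symmetric])
    ultimately obtain \<eta>' where \<eta>': "\<And>\<theta>. (\<eta> has_vector_derivative \<eta>' \<theta>) (at \<theta>)"
      "(\<eta>' has_vector_derivative of_real ((M.expectation Z)\<^sup>2 - M.expectation (\<lambda>\<omega>. (Z \<omega>)\<^sup>2))) (at 0)"
      using M.log_char_derivatives[OF _ Z2] by auto
    have refl: "((\<lambda>x. f (- x)) has_vector_derivative - D) (at x)"
      if "(f has_vector_derivative D) (at (- x))" for f :: "real \<Rightarrow> complex" and D x
    proof -
      have "((\<lambda>x::real. - x) has_vector_derivative - 1) (at x)"
        by (rule has_vector_derivative_minus[OF has_vector_derivative_id])
      from vector_diff_chain_at[OF this that] show ?thesis by (simp add: o_def)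
    qed
    have "(\<eta> has_vector_derivative of_real (H h) * (\<psi>' \<theta> - \<psi>' (- \<theta>))) (at \<theta>)" for \<theta>
      unfolding \<eta>_def using refl[OF \<psi>'(1), of \<theta>] \<psi>'(1)[of \<theta>]
      by (auto intro!: derivative_eq_intros)
    then have \<eta>'_eq: "\<eta>' = (\<lambda>\<theta>. of_real (H h) * (\<psi>' \<theta> - \<psi>' (- \<theta>)))"
      using \<eta>'(1) vector_derivative_unique_at by blast
    have "((\<lambda>\<theta>. \<psi>' (- \<theta>)) has_vector_derivative - of_real (m\<^sup>2 - q)) (at 0)"
      by (rule refl) (simp only: minus_zero \<psi>'(2))
    then have "(\<eta>' has_vector_derivative of_real (H h) * (of_real (m\<^sup>2 - q) - - of_real (m\<^sup>2 - q))) (at 0)"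
      unfolding \<eta>'_eq
      by (intro has_vector_derivative_mult_right has_vector_derivative_diff \<psi>'(2))
    with \<eta>'(2) have "complex_of_real ((M.expectation Z)\<^sup>2 - M.expectation (\<lambda>\<omega>. (Z \<omega>)\<^sup>2))
        = of_real (H h) * (of_real (m\<^sup>2 - q) - - of_real (m\<^sup>2 - q))"
      by (rule vector_derivative_unique_at)
    then have "M.expectation (\<lambda>\<omega>. (Z \<omega>)\<^sup>2) = 2 * H h * (q - m\<^sup>2)"
      unfolding EZ by (simp add: algebra_simps flip: of_real_mult of_real_add of_real_diff of_real_minus)
    moreover have "M.expectation (\<lambda>\<omega>. (Z \<omega>)\<^sup>2) = 2 * q - 2 * (LINT \<omega>|M. X s \<omega> * X (s + h) \<omega>)"
      unfolding expand using sq prod by (simp add: moments)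
    ultimately show ?thesis by (simp add: algebra_simps)
  qed
  have "(LINT \<omega>|M. X t \<omega> * X (t + h) \<omega>) = m\<^sup>2 + (q - m\<^sup>2) * (1 - H \<bar>h\<bar>)"
  proof (cases "0 \<le> h")
    case False
    then show ?thesis using pos[of "- h" "t + h"] by (simp add: mult.commute)
  qed (use pos in simp)
  moreover have "covariance M (X t) (X (t + h)) = (LINT \<omega>|M. X t \<omega> * X (t + h) \<omega>) - m\<^sup>2"
  proof -
    have "covariance M (X t) (X (t + h))
        = (LINT \<omega>|M. X t \<omega> * X (t + h) \<omega> - m * X t \<omega> - m * X (t + h) \<omega> + m\<^sup>2)"
      unfolding covariance_def moments by (simp add: algebra_simps power2_eq_square)
    also have "\<dots> = (LINT \<omega>|M. X t \<omega> * X (t + h) \<omega>) - m\<^sup>2"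
      using int prod M.prob_space by (simp add: moments power2_eq_square)
    finally show ?thesis .
  qed
  ultimately have "covariance M (X t) (X (t + h)) = - (m\<^sup>2 - q) * (1 - H \<bar>h\<bar>)" by simp
  then show "complex_of_real (covariance M (X t) (X (t + h))) =
      - vector_derivative (\<lambda>\<theta>. vector_derivative \<psi> (at \<theta>)) (at 0) * complex_of_real (1 - H \<bar>h\<bar>)"
    by (simp only: \<psi>'' of_real_mult of_real_minus)
qed

section \<open>Existence, stationarity and covariance\<close>

theorem theorem3:
  fixes P :: "'a measure" and X\<^sub>0 :: "'a \<Rightarrow> real" and \<phi> \<psi> :: "real \<Rightarrow> complex"
    and D :: "real measure" and H :: "real \<Rightarrow> real"
  assumes "prob_space P" and "X\<^sub>0 \<in> borel_measurable P"
    and "infinitely_divisible (distr P borel X\<^sub>0)"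
    and "\<phi> = (\<lambda>\<theta>. LINT \<omega>|P. iexp (\<theta> * X\<^sub>0 \<omega>))"
    and "\<psi> = dist_log \<phi>"
    and "real_distribution D" and "H = cdf D"
    and "H 0 = 0" and "concave_on {0..} H"
  shows
    "(\<exists>\<mu> :: nat \<Rightarrow> (nat \<Rightarrow> real) \<Rightarrow> (nat \<Rightarrow> real) measure.
      (\<forall>n\<ge>1. \<forall>t. ordered_times n t \<longrightarrow>
         infinitely_divisible_vec n (\<mu> n t) \<and>
         (\<forall>\<theta>. char_vec n (\<mu> n t) \<theta> = fdd_char \<psi> H n \<theta> t)) \<and>
      kolmogorov_consistent \<mu> \<and>
      (\<exists>(M :: (real \<Rightarrow> real) measure) X.
         real_process M X \<and>
         (\<forall>n\<ge>1. \<forall>t. ordered_times n t \<longrightarrow> joint_law M X n t = \<mu> n t) \<and>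
         has_fdd_char M X (fdd_char \<psi> H) \<and>
         stationary M X \<and>
         (\<forall>t \<theta>. (LINT \<omega>|M. iexp (\<theta> * X t \<omega>)) = \<phi> \<theta>))) \<and>
     (integrable P (\<lambda>\<omega>. (X\<^sub>0 \<omega>)\<^sup>2) \<longrightarrow>
      (\<forall>(M :: 'w measure) X. real_process M X \<and> has_fdd_char M X (fdd_char \<psi> H) \<longrightarrow>
         (\<forall>t h. integrable M (\<lambda>\<omega>. (X t \<omega>)\<^sup>2) \<and>
            complex_of_real (covariance M (X t) (X (t + h))) =
              - vector_derivative (\<lambda>\<theta>. vector_derivative \<psi> (at \<theta>)) (at 0) *
                complex_of_real (1 - H \<bar>h\<bar>))))"
proof -
  interpret P: prob_space P by fact
  interpret D: real_distribution D by fact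
  define \<nu> where "\<nu> = distr P borel X\<^sub>0"
  have id: "infinitely_divisible \<nu>" using assms(3) by (simp add: \<nu>_def)
  have \<phi>: "\<phi> = char \<nu>"
    using assms(2) by (simp add: fun_eq_iff assms(4) \<nu>_def char_def integral_distr)
  have \<psi>_eq: "\<psi> = dist_log (char \<nu>)" by (simp add: assms(5) \<phi>)
  note \<psi> = dist_log_char[OF id, folded \<psi>_eq]
  have H: "concave_on {0..} H" "mono H" "\<And>x. H x \<le> 1"
    using assms(9) D.cdf_nondecreasing D.cdf_bounded_prob by (auto simp: assms(7) mono_def)
  note law = ex_law_fdd_power[OF id \<psi>_eq H]
  define \<mu> where "\<mu> n t = (SOME \<mu>. prob_law n \<mu> \<and> (\<forall>\<theta>. char_vec n \<mu> \<theta> = fdd_char \<psi> H n \<theta> t))" for n t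
  have \<mu>: "prob_law n (\<mu> n t)" "char_vec n (\<mu> n t) \<theta> = fdd_char \<psi> H n \<theta> t" if "ordered_times n t" for n t \<theta>
    using someI_ex[OF law[OF that, of 1, simplified, folded fdd_char_def]] by (auto simp: \<mu>_def)
  interpret F: fdd_family \<psi> H \<mu>
    by standard (use \<mu> \<psi>(2) in auto)
  have divisible: "infinitely_divisible_vec n (\<mu> n t)" if t: "ordered_times n t" for n t
  proof (rule infinitely_divisible_vecI[OF \<mu>(1)[OF t]])
    fix m :: nat assume "1 \<le> m"
    then have "exp (of_real (1 / m) * z) ^ m = exp z" for z :: complex
      by (simp add: exp_of_nat_mult[symmetric])
    then show "\<exists>\<nu>. prob_law n \<nu> \<and> (\<forall>\<theta>. char_vec n \<nu> \<theta> ^ m = char_vec n (\<mu> n t) \<theta>)"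
      using law[OF t, of "1 / m"] \<mu>(2)[OF t] by (auto simp: fdd_char_def)
  qed
  obtain M :: "(real \<Rightarrow> real) measure" and X where X: "real_process M X"
    and joint: "\<And>n t. 1 \<le> n \<Longrightarrow> ordered_times n t \<Longrightarrow> joint_law M X n t = \<mu> n t"
    using F.ex_process by metis
  have fdd: "has_fdd_char M X (fdd_char \<psi> H)"
    unfolding has_fdd_char_def using char_vec_joint_law[OF X] joint \<mu>(2) by metis
  have stat: "stationary M X"
  proof (rule stationaryI[OF X])
    fix h n and t :: "nat \<Rightarrow> real" assume t: "1 \<le> n" "ordered_times n t"
    then have "ordered_times n (\<lambda>k. t k + h)" by (simp add: monotone_on_def)
    then show "joint_law M X n (\<lambda>k. t k + h) = joint_law M X n t"
      using t F.shift by (simp add: joint)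
  qed
  have marginal: "(LINT \<omega>|M. iexp (\<theta> * X t \<omega>)) = \<phi> \<theta>" for t \<theta>
    using fdd_char_marginal[OF X fdd assms(8)] \<psi>(3) \<phi> by simp
  have exp_\<psi>: "exp (\<psi> \<theta>) = (LINT \<omega>|P. iexp (\<theta> * X\<^sub>0 \<omega>))" for \<theta>
    by (simp only: \<psi>(3) \<phi>[symmetric] assms(4))
  have cov: "integrable N (\<lambda>\<omega>. (Y t \<omega>)\<^sup>2) \<and> complex_of_real (covariance N (Y t) (Y (t + h))) =
      - vector_derivative (\<lambda>\<theta>. vector_derivative \<psi> (at \<theta>)) (at 0) * complex_of_real (1 - H \<bar>h\<bar>)"
    if "integrable P (\<lambda>\<omega>. (X\<^sub>0 \<omega>)\<^sup>2)" "real_process N Y" "has_fdd_char N Y (fdd_char \<psi> H)"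
    for N :: "'w measure" and Y t h
    using covariance_fdd[OF assms(1,2) that(1) \<psi>(1,2) exp_\<psi> assms(8) that(2,3)] by (intro conjI)
  show ?thesis
  proof (intro conjI exI[of _ \<mu>] exI[of _ M] exI[of _ X])
    show "\<forall>n\<ge>1. \<forall>t. ordered_times n t \<longrightarrow> infinitely_divisible_vec n (\<mu> n t) \<and>
        (\<forall>\<theta>. char_vec n (\<mu> n t) \<theta> = fdd_char \<psi> H n \<theta> t)"
      using divisible \<mu>(2) by simp
    show "kolmogorov_consistent \<mu>" by (rule F.consistent)
    show "\<forall>n\<ge>1. \<forall>t. ordered_times n t \<longrightarrow> joint_law M X n t = \<mu> n t"
      using joint by blast
    show "\<forall>t \<theta>. (LINT \<omega>|M. iexp (\<theta> * X t \<omega>)) = \<phi> \<theta>"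
      using marginal by blast
    show "integrable P (\<lambda>\<omega>. (X\<^sub>0 \<omega>)\<^sup>2) \<longrightarrow>
      (\<forall>(M :: 'w measure) X. real_process M X \<and> has_fdd_char M X (fdd_char \<psi> H) \<longrightarrow>
         (\<forall>t h. integrable M (\<lambda>\<omega>. (X t \<omega>)\<^sup>2) \<and>
            complex_of_real (covariance M (X t) (X (t + h))) =
              - vector_derivative (\<lambda>\<theta>. vector_derivative \<psi> (at \<theta>)) (at 0) *
                complex_of_real (1 - H \<bar>h\<bar>)))"
      using cov by blast
  qed (fact X fdd stat)+
qed

end
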